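(* Let $\rho\in[0,1)$, let $S\in\mathbb{R}^{N\times N}$ be symmetric positive definite, let $\{\sigma_k\}_{k\ge0}$ be a positive sequence with $\sigma_k\ge\sigma_{\min}>0$ for all $k\ge0$, and let $\{\tau_k\}_{k\ge0}$ be a positive sequence satisfying $$\tau_k\ge\tau_{\min}>0,\qquad \tau_{k+1}\le(1+\nu_k)\tau_k,\qquad \nu_k\ge0,\qquad \sum_{k=0}^\infty\nu_k<+\infty .$$ Let $\{x^k\},\{\Delta^k\},\{w^k\}\subset\mathbb{R}^N$ and $\{y^k:=(\lambda^k,\mu^k)\}\subset\mathbb{R}^M$ be (infinite) sequences generated by the rip$^2$ALM (defined in the context) with these parameters. If $\ell$ admits a saddle point (i.e. $(\partial\ell)^{-1}(0,0)\neq\emptyset$), then the following hold. (i) The sequences $\{x^k\}$, $\{w^k\}$ and $\{y^k\}$ are all bounded. (ii) $\lim_{k\to\infty}\Delta^{k+1}=0$, $\lim_{k\to\infty}p^{k+1}=0$ and $\lim_{k\to\infty}u^{k+1}=0$, where for all $k\ge0$ $$p^{k+1}:=\Delta^{k+1}-\tau_k\sigma_k^{-1}S(x^{k+1}-x^k),\qquad u^{k+1}:=\sigma_k^{-1}(y^k-y^{k+1}).$$ (iii) Both sequences $\{F(x^{k+1},u^{k+1})\}$ and $\{G(p^{k+1},y^{k+1})\}$ converge to the common optimal value of the primal problem $\min_{x\in\mathbb{R}^N}F(x,0)$ and the dual problem $\max_{y\in\mathbb{R}^M}G(0,y)$. (iv) Any accumulation point of $\{x^k\}$ is an optimal solution of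 the primal problem $\min_x F(x,0)$ (equivalently, of $\min\{f(x): Ax=b,\ g(x)\le0\}$), and any accumulation point of $\{y^k\}$ is an optimal solution of the dual problem $\max_y G(0,y)$. (v) The sequence $\{y^k\}$ converges to an optimal solution of the dual problem $\max_y G(0,y)$.
   Context: Problem. $f:\mathbb{R}^N\to\mathbb{R}\cup\{+\infty\}$ is a proper closed (lower semicontinuous) convex function, $A\in\mathbb{R}^{m_1\times N}$, $b\in\mathbb{R}^{m_1}$, and $g=(g_1,\dots,g_{m_2})$ with each $g_i:\mathbb{R}^N\to\mathbb{R}$ continuously differentiable and convex; $M:=m_1+m_2$. The problem is $\min_x f(x)$ subject to $Ax=b$, $g(x)\le0$ (componentwise). Functions $F,\ell,G$. For $x\in\mathbb{R}^N$ and $u=(r,s)\in\mathbb{R}^{m_1}\times\mathbb{R}^{m_2}$, $F(x,u)=f(x)$ if $Ax-b+r=0$ and $g(x)+s\le0$, and $F(x,u)=+\infty$ otherwise. The Lagrangian is, for $y=(\lambda,\mu)\in\mathbb{R}^{m_1}\times\mathbb{R}^{m_2}$, $$\ell(x,y)=\inf_{u\in\mathbb{R}^M}\{F(x,u)-\langle u,y\rangle\}=\begin{cases}f(x)+\langle\lambda,Ax-b\rangle+\langle\mu,g(x)\rangle,&\mu\ge0,\\-\infty,&\text{otherwise.}\end{cases}$$ Also $G(p,y):=\inf_{x\in\mathbb{R}^N,u\in\mathbb{R}^M}\{F(x,u)-\langle x,p\rangle-\langle u,y\rangle\}$. Subdifferential of $\ell$: $(p,u)\in\partial\ell(x,y)$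 iff $\ell(x',y)\ge\ell(x,y)+\langle p,x'-x\rangle$ for all $x'\in\mathbb{R}^N$ and $\ell(x,y')\le\ell(x,y)-\langle u,y'-y\rangle$ for all $y'\in\mathbb{R}^M$. For $\mu\ge0$ this gives $\partial\ell(x,(\lambda,\mu))=\{\partial f(x)+A^\top\lambda+\nabla g(x)^\top\mu\}\times(\{b-Ax\}\times\{-g(x)+\mathcal{N}_{\mathbb{R}^{m_2}_+}(\mu)\})$, where $\nabla g(x)$ is the Jacobian and $\mathcal{N}_{\mathbb{R}^{m_2}_+}$ the normal cone of $\mathbb{R}^{m_2}_+$. $(\partial\ell)^{-1}(p,u):=\{(x,y):(p,u)\in\partial\ell(x,y)\}$; a saddle point of $\ell$ is an element of $(\partial\ell)^{-1}(0,0)$. Augmented Lagrangian: for $\sigma>0$ and $(x,\lambda,\mu)\in\mathbb{R}^N\times\mathbb{R}^{m_1}\times\mathbb{R}^{m_2}_+$, $$\mathcal{L}_\sigma(x,\lambda,\mu)=f(x)+\langle\lambda,Ax-b\rangle+\tfrac{\sigma}{2}\|Ax-b\|^2+\tfrac{1}{2\sigma}\|\max\{0,\mu+\sigma g(x)\}\|^2-\tfrac{1}{2\sigma}\|\mu\|^2 .$$ $\partial_x\mathcal{L}_\sigma$ is its convex subdifferential in $x$. Norms are Euclidean; $\|x\|_S:=\sqrt{\langle x,Sx\rangle}$; $\max$ and $\min$ of vectors are componentwise. rip$^2$ALM. Inputs: $\rho\in[0,1)$, positive $\{\sigma_k\}$, $\{\tau_k\}$ bounded away from $0$, $S$ symmetric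 positive definite; arbitrary $w^0,x^0\in\mathbb{R}^N$, $\lambda^0\in\mathbb{R}^{m_1}$, $\mu^0\in\mathbb{R}^{m_2}_+$. For $k=0,1,2,\dots$: Step 1: find any $x^{k+1}$ and $\Delta^{k+1}$ in $\mathbb{R}^N$ (by approximately minimizing $\mathcal{L}_{\sigma_k}(x,\lambda^k,\mu^k)+\frac{\tau_k}{2\sigma_k}\|x-x^k\|_S^2$ over $x$) such that $$\Delta^{k+1}\in\partial_x\mathcal{L}_{\sigma_k}(x^{k+1},\lambda^k,\mu^k)+\tau_k\sigma_k^{-1}S(x^{k+1}-x^k)$$ and $$2|\langle w^k-x^{k+1},\sigma_k\Delta^{k+1}\rangle|+\|\sigma_k\Delta^{k+1}\|^2\le\rho\Big(\|\sigma_k(Ax^{k+1}-b)\|^2+\|\min\{\mu^k,-\sigma_kg(x^{k+1})\}\|^2+\tau_k\|x^{k+1}-x^k\|_S^2\Big).$$ Step 2: set $\lambda^{k+1}=\lambda^k+\sigma_k(Ax^{k+1}-b)$, $\mu^{k+1}=\max\{0,\mu^k+\sigma_kg(x^{k+1})\}$, $w^{k+1}=w^k-\sigma_k\Delta^{k+1}$. *)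

theory Defs
  imports "HOL-Analysis.Analysis"
begin

section \<open>Convex analysis\<close>

definition proper_fun :: "('a \<Rightarrow> ereal) \<Rightarrow> bool" where
  "proper_fun f \<longleftrightarrow> (\<forall>x. f x \<noteq> - \<infinity>) \<and> (\<exists>x. f x < \<infinity>)"

(* Values are never - infinity below (properness), so the right-hand side never contains
   infinity - infinity; the case of a strict convex combination is the only one with content. *)
definition convex_ereal_fun :: "('a::real_vector \<Rightarrow> ereal) \<Rightarrow> bool" where
  "convex_ereal_fun f \<longleftrightarrow>
    (\<forall>x y. \<forall>t\<in>{0<..<1}. f ((1 - t) *\<^sub>R x + t *\<^sub>R y) \<le> ereal (1 - t) * f x + ereal t * f y)"

definition lower_semicontinuous :: "('a::topological_space \<Rightarrow> ereal) \<Rightarrow> bool" where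
  "lower_semicontinuous f \<longleftrightarrow> (\<forall>x. f x \<le> Liminf (at x) f)"

definition subdifferential :: "('a::real_inner \<Rightarrow> ereal) \<Rightarrow> 'a \<Rightarrow> 'a set" where
  "subdifferential h x = {v. \<forall>x'. h x' \<ge> h x + ereal (v \<bullet> (x' - x))}"

definition continuously_differentiable :: "('a::real_inner \<Rightarrow> real) \<Rightarrow> bool" where
  "continuously_differentiable h \<longleftrightarrow>
    (\<exists>dh. (\<forall>x. GDERIV h x :> dh x) \<and> continuous_on UNIV dh)"

definition sym_pos_def :: "real^'n^'n \<Rightarrow> bool" where
  "sym_pos_def S \<longleftrightarrow> transpose S = S \<and> (\<forall>v. v \<noteq> 0 \<longrightarrow> v \<bullet> (S *v v) > 0)"

definition weighted_norm :: "real^'n^'n \<Rightarrow> real^'n \<Rightarrow> real" where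
  "weighted_norm S v = sqrt (v \<bullet> (S *v v))"

definition vmax :: "real^'m \<Rightarrow> real^'m \<Rightarrow> real^'m" where
  "vmax v w = (\<chi> i. max (v $ i) (w $ i))"

definition vmin :: "real^'m \<Rightarrow> real^'m \<Rightarrow> real^'m" where
  "vmin v w = (\<chi> i. min (v $ i) (w $ i))"

definition accumulation_point :: "(nat \<Rightarrow> 'a::topological_space) \<Rightarrow> 'a \<Rightarrow> bool" where
  "accumulation_point X a \<longleftrightarrow> (\<exists>r. strict_mono r \<and> (X \<circ> r) \<longlonglongrightarrow> a)"

section \<open>The constrained problem: minimize f x subject to A x = b and g x \<le> 0\<close>

(* Primal perturbations u = (r, s) and multipliers y = (lambda, mu) are pairs; the product
   type carries the Euclidean inner product and norm. The order on vectors is componentwise. *)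

definition perturbed_objective ::
  "(real^'n \<Rightarrow> ereal) \<Rightarrow> real^'n^'m1 \<Rightarrow> real^'m1 \<Rightarrow> (real^'n \<Rightarrow> real^'m2) \<Rightarrow>
   real^'n \<Rightarrow> (real^'m1) \<times> (real^'m2) \<Rightarrow> ereal" where
  "perturbed_objective f A b g x u =
    (if A *v x - b + fst u = 0 \<and> g x + snd u \<le> 0 then f x else \<infinity>)"

(* For f x finite the infimum is f x + <lambda, A x - b> + <mu, g x> if mu \<ge> 0, and - infinity
   otherwise. For f x = infinity it is infinity for every multiplier. *)
definition lagrangian ::
  "(real^'n \<Rightarrow> ereal) \<Rightarrow> real^'n^'m1 \<Rightarrow> real^'m1 \<Rightarrow> (real^'n \<Rightarrow> real^'m2) \<Rightarrow>
   real^'n \<Rightarrow> (real^'m1) \<times> (real^'m2) \<Rightarrow> ereal" where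
  "lagrangian f A b g x y = (INF u. perturbed_objective f A b g x u - ereal (u \<bullet> y))"

definition dual_perturbed_objective ::
  "(real^'n \<Rightarrow> ereal) \<Rightarrow> real^'n^'m1 \<Rightarrow> real^'m1 \<Rightarrow> (real^'n \<Rightarrow> real^'m2) \<Rightarrow>
   real^'n \<Rightarrow> (real^'m1) \<times> (real^'m2) \<Rightarrow> ereal" where
  "dual_perturbed_objective f A b g p y =
    (INF (x, u). perturbed_objective f A b g x u - ereal (x \<bullet> p) - ereal (u \<bullet> y))"

definition lagrangian_subdifferential ::
  "(real^'n \<Rightarrow> ereal) \<Rightarrow> real^'n^'m1 \<Rightarrow> real^'m1 \<Rightarrow> (real^'n \<Rightarrow> real^'m2) \<Rightarrow>
   real^'n \<Rightarrow> (real^'m1) \<times> (real^'m2) \<Rightarrow> ((real^'n) \<times> (real^'m1) \<times> (real^'m2)) set" where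
  "lagrangian_subdifferential f A b g x y =
    {(p, u). (\<forall>x'. lagrangian f A b g x' y \<ge> lagrangian f A b g x y + ereal (p \<bullet> (x' - x))) \<and>
             (\<forall>y'. lagrangian f A b g x y' \<le> lagrangian f A b g x y - ereal (u \<bullet> (y' - y)))}"

definition lagrangian_subdifferential_inv ::
  "(real^'n \<Rightarrow> ereal) \<Rightarrow> real^'n^'m1 \<Rightarrow> real^'m1 \<Rightarrow> (real^'n \<Rightarrow> real^'m2) \<Rightarrow>
   real^'n \<Rightarrow> (real^'m1) \<times> (real^'m2) \<Rightarrow> ((real^'n) \<times> (real^'m1) \<times> (real^'m2)) set" where
  "lagrangian_subdifferential_inv f A b g p u =
    {(x, y). (p, u) \<in> lagrangian_subdifferential f A b g x y}"

definition augmented_lagrangian ::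
  "(real^'n \<Rightarrow> ereal) \<Rightarrow> real^'n^'m1 \<Rightarrow> real^'m1 \<Rightarrow> (real^'n \<Rightarrow> real^'m2) \<Rightarrow>
   real \<Rightarrow> real^'n \<Rightarrow> real^'m1 \<Rightarrow> real^'m2 \<Rightarrow> ereal" where
  "augmented_lagrangian f A b g \<sigma> x l \<mu> =
    f x + ereal (l \<bullet> (A *v x - b) + \<sigma> / 2 * (norm (A *v x - b))\<^sup>2
                 + 1 / (2 * \<sigma>) * (norm (vmax 0 (\<mu> + \<sigma> *\<^sub>R g x)))\<^sup>2
                 - 1 / (2 * \<sigma>) * (norm \<mu>)\<^sup>2)"

section \<open>The algorithm\<close>

(* The sequences are generated by the algorithm: the nondeterministic choice of (x (k+1), Delta (k+1))
   in Step 1 and the arbitrary initial data are left open; Delta 0 is never used. *)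
definition rip2ALM ::
  "(real^'n \<Rightarrow> ereal) \<Rightarrow> real^'n^'m1 \<Rightarrow> real^'m1 \<Rightarrow> (real^'n \<Rightarrow> real^'m2) \<Rightarrow>
   real \<Rightarrow> (nat \<Rightarrow> real) \<Rightarrow> (nat \<Rightarrow> real) \<Rightarrow> real^'n^'n \<Rightarrow>
   (nat \<Rightarrow> real^'n) \<Rightarrow> (nat \<Rightarrow> real^'n) \<Rightarrow> (nat \<Rightarrow> real^'n) \<Rightarrow>
   (nat \<Rightarrow> real^'m1) \<Rightarrow> (nat \<Rightarrow> real^'m2) \<Rightarrow> bool" where
  "rip2ALM f A b g \<rho> \<sigma> \<tau> S x \<Delta> w l \<mu> \<longleftrightarrow>
    0 \<le> \<mu> 0 \<and>
    (\<forall>k.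
      \<Delta> (Suc k) \<in> (\<lambda>d. d + (\<tau> k / \<sigma> k) *\<^sub>R (S *v (x (Suc k) - x k))) `
        subdifferential (\<lambda>z. augmented_lagrangian f A b g (\<sigma> k) z (l k) (\<mu> k)) (x (Suc k)) \<and>
      2 * \<bar>(w k - x (Suc k)) \<bullet> (\<sigma> k *\<^sub>R \<Delta> (Suc k))\<bar> + (norm (\<sigma> k *\<^sub>R \<Delta> (Suc k)))\<^sup>2
        \<le> \<rho> * ((norm (\<sigma> k *\<^sub>R (A *v x (Suc k) - b)))\<^sup>2
               + (norm (vmin (\<mu> k) (- (\<sigma> k *\<^sub>R g (x (Suc k))))))\<^sup>2
               + \<tau> k * (weighted_norm S (x (Suc k) - x k))\<^sup>2) \<and>
      l (Suc k) = l k + \<sigma> k *\<^sub>R (A *v x (Suc k) - b) \<and>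
      \<mu> (Suc k) = vmax 0 (\<mu> k + \<sigma> k *\<^sub>R g (x (Suc k))) \<and>
      w (Suc k) = w k - \<sigma> k *\<^sub>R \<Delta> (Suc k))"

end

(*
A subgradient p of the augmented Lagrangian at the new point x' is a subgradient of the Lagrangian at
(x', y'), where y' is the updated multiplier; together with the residual u = (y - y') / sigma this
gives 0 <= <p, x' - xs> + <u, y' - ys> for every saddle point (xs, ys). Multiplied by sigma, and with
the error criterion absorbing the cross term in w, this becomes a quasi-Fejer inequality for the energy
|w - xs|^2 + |y - ys|^2 + tau |x - xs|_S^2. Convergence of the energy bounds the iterates and makes
all residuals vanish, so the objective values are squeezed to the optimal value. As (xs, q) is a saddle
point for every cluster point q of y, Opial's argument applies to y with xs fixed.
*)

theory Submission
  imports Defs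
begin

section \<open>Quasi-monotone sequences and quadratic forms\<close>

text \<open>A Fejer estimate on x and y alone is left with the product of the error \<Delta> and x'
  - xs, which smallness of \<Delta> does not make summable. The auxiliary sequence moves by exactly
  -\<sigma> \<Delta>, so expanding |w' - xs|^2 turns twice \<sigma> times that product into a
  telescoping difference plus |\<sigma> \<Delta>|^2 - 2 <w - x', \<sigma> \<Delta>>, which the
  left-hand side of the error criterion dominates. Scaling by \<sigma> also clears the varying
  factor 1/\<sigma>, so only the growth of \<tau> disturbs the energy; the factors 1 + \<nu> come
  from there. Opial's argument is run on y only: the w and x terms of the energy are not known to
  converge separately, but with \<open>xs\<close> fixed they cancel between energies with different
  dual centres. Dual solutions are represented by a lower bound on the Lagrangian that is pointwise
  in z, a form that survives limits of y.\<close>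

lemma quasi_decreasing_convergent:
  fixes a \<nu> :: "nat \<Rightarrow> real"
  assumes nonneg: "\<And>k. 0 \<le> a k" and step: "\<And>k. a (Suc k) \<le> (1 + \<nu> k) * a k"
    and \<nu>: "\<And>k. 0 \<le> \<nu> k" and summable: "summable \<nu>"
  shows "convergent a"
proof -
  \<comment> \<open>Division by these products turns the perturbed inequality into monotonicity.
    They increase and stay below the exponential of the sum of \<nu>, so their limit can be
    multiplied back in.\<close>
  define P where "P k = (\<Prod>i<k. 1 + \<nu> i)" for k
  have P_ge: "1 \<le> P k" for k
    unfolding P_def by (intro prod_ge_1) (simp add: \<nu>)
  have "incseq P"
  proof (rule incseq_SucI)
    fix k
    have "P k * 1 \<le> P k * (1 + \<nu> k)"
      using P_ge[of k] \<nu>[of k] by (intro mult_left_mono) auto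
    then show "P k \<le> P (Suc k)"
      by (simp add: P_def)
  qed
  moreover have "P k \<le> exp (suminf \<nu>)" for k
  proof -
    have "P k \<le> (\<Prod>i<k. exp (\<nu> i))"
      unfolding P_def by (intro prod_mono) (simp add: \<nu> add_nonneg_nonneg)
    also have "\<dots> = exp (\<Sum>i<k. \<nu> i)"
      by (simp add: exp_sum)
    also have "\<dots> \<le> exp (suminf \<nu>)"
      by (simp add: sum_le_suminf summable \<nu>)
    finally show ?thesis .
  qed
  ultimately obtain L where L: "P \<longlonglongrightarrow> L"
    using incseq_convergent by blast
  have "decseq (\<lambda>k. a k / P k)"
  proof (rule decseq_SucI)
    fix k
    have "a (Suc k) / P (Suc k) \<le> ((1 + \<nu> k) * a k) / P (Suc k)"
      using P_ge[of "Suc k"] by (intro divide_right_mono step) linarith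
    also have "\<dots> = a k / P k"
    proof -
      have "P (Suc k) = (1 + \<nu> k) * P k"
        by (simp add: P_def)
      then show ?thesis
        using \<nu>[of k] by simp
    qed
    finally show "a (Suc k) / P (Suc k) \<le> a k / P k" .
  qed
  moreover have "0 \<le> a k / P k" for k
    using nonneg[of k] P_ge[of k] by simp
  ultimately obtain M where M: "(\<lambda>k. a k / P k) \<longlonglongrightarrow> M"
    using decseq_convergent by blast
  have "(\<lambda>k. a k / P k * P k) \<longlonglongrightarrow> M * L"
    by (intro tendsto_mult M L)
  moreover have "a k / P k * P k = a k" for k
    using P_ge[of k] by simp
  ultimately show ?thesis
    by (auto simp: convergent_def)
qed

section \<open>Positive definite quadratic forms\<close>

lemma sym_pos_def_nonneg: "sym_pos_def S \<Longrightarrow> 0 \<le> v \<bullet> (S *v v)"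
  unfolding sym_pos_def_def by (cases "v = 0") (auto intro: less_imp_le)

lemma sym_pos_def_commute:
  assumes "sym_pos_def S"
  shows "v \<bullet> (S *v w) = w \<bullet> (S *v v)"
  using assms unfolding sym_pos_def_def
  by (metis dot_lmul_matrix inner_commute transpose_matrix_vector)

text \<open>The constant is the minimum of the form over the compact unit sphere; homogeneity of
  degree two carries it to all vectors.\<close>

lemma sym_pos_def_coercive:
  fixes S :: "real^'n^'n"
  assumes "sym_pos_def S"
  obtains c where "0 < c" "\<And>v. c * (norm v)\<^sup>2 \<le> v \<bullet> (S *v v)"
proof -
  have "compact (sphere (0::real^'n) 1)" "sphere (0::real^'n) 1 \<noteq> {}"
    by auto
  moreover have "continuous_on (sphere 0 1) (\<lambda>v. v \<bullet> (S *v v))"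
    by (rule continuous_on_inner[OF continuous_on_id
          linear_continuous_on[OF matrix_vector_mul_bounded_linear]])
  ultimately have "\<exists>m\<in>sphere 0 1. \<forall>v\<in>sphere 0 1. m \<bullet> (S *v m) \<le> v \<bullet> (S *v v)"
    by (rule continuous_attains_inf)
  then obtain m where m: "m \<in> sphere 0 1"
    and min: "\<And>v. v \<in> sphere 0 1 \<Longrightarrow> m \<bullet> (S *v m) \<le> v \<bullet> (S *v v)"
    by blast
  show thesis
  proof
    show "0 < m \<bullet> (S *v m)"
    proof -
      have "m \<noteq> 0"
        using m by auto
      then show ?thesis
        using assms unfolding sym_pos_def_def by blast
    qed
    fix v :: "real^'n"
    show "m \<bullet> (S *v m) * (norm v)\<^sup>2 \<le> v \<bullet> (S *v v)"
    proof (cases "v = 0")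
      case False
      have "m \<bullet> (S *v m) \<le> sgn v \<bullet> (S *v sgn v)"
        using False by (intro min) (simp add: norm_sgn)
      also have "\<dots> = (v \<bullet> (S *v v)) / (norm v)\<^sup>2"
        by (simp add: sgn_div_norm matrix_vector_mult_scaleR power2_eq_square field_simps)
      finally show ?thesis
        using False by (simp add: field_simps)
    qed simp
  qed
qed

lemma weighted_norm_sq: "sym_pos_def S \<Longrightarrow> (weighted_norm S v)\<^sup>2 = v \<bullet> (S *v v)"
  by (simp add: weighted_norm_def sym_pos_def_nonneg)

text \<open>Division by t and the limit at 0 from the right remove the quadratic term. This extracts
  first-order information from inequalities along a segment.\<close>

lemma nonneg_of_linear_plus_quadratic:
  fixes q K :: real
  assumes "\<And>t. 0 < t \<Longrightarrow> t < 1 \<Longrightarrow> 0 \<le> t * q + t\<^sup>2 * K"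
  shows "0 \<le> q"
proof (rule tendsto_lowerbound)
  show "((\<lambda>t. q + t * K) \<longlongrightarrow> q) (at_right 0)"
    by (auto intro!: tendsto_eq_intros)
  show "\<forall>\<^sub>F t in at_right 0. 0 \<le> q + t * K"
  proof (rule eventually_at_right_less[of 0, THEN eventually_elim2])
    show "\<forall>\<^sub>F t in at_right 0. t < (1::real)"
      by (rule order_tendstoD) (auto intro: tendsto_eq_intros)
    fix t :: real
    assume t: "0 < t" "t < 1"
    have "0 \<le> t * (q + t * K)"
      using assms[OF t] by (simp add: algebra_simps power2_eq_square)
    then show "0 \<le> q + t * K"
      using t by (simp add: zero_le_mult_iff)
  qed
qed simp

lemma inner_nonneg_vec:
  fixes v w :: "real^'m"
  shows "0 \<le> v \<Longrightarrow> 0 \<le> w \<Longrightarrow> 0 \<le> v \<bullet> w"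
  by (auto simp: inner_vec_def less_eq_vec_def intro!: sum_nonneg)

lemma inner_nonpos_vec:
  fixes v w :: "real^'m"
  shows "0 \<le> v \<Longrightarrow> w \<le> 0 \<Longrightarrow> v \<bullet> w \<le> 0"
  using inner_nonneg_vec[of v "- w"] by (simp add: less_eq_vec_def)

lemma norm_sq_vec: "(norm v)\<^sup>2 = (\<Sum>i\<in>UNIV. (v $ i)\<^sup>2)" for v :: "real^'m"
  by (simp add: norm_vec_def L2_set_def sum_nonneg)

lemma norm_sq_add_scaleR:
  "(norm (v + c *\<^sub>R w))\<^sup>2 = (norm v)\<^sup>2 + 2 * c * (v \<bullet> w) + c\<^sup>2 * (norm w)\<^sup>2"
  by (simp only: power2_norm_eq_inner)
    (simp add: inner_add_left inner_add_right inner_commute power2_eq_square algebra_simps)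

lemma lower_semicontinuous_le_limit:
  assumes "lower_semicontinuous f" "X \<longlonglongrightarrow> z" "(\<lambda>k. f (X k)) \<longlonglongrightarrow> c"
  shows "f z \<le> c"
proof (rule dense_le)
  fix e assume e: "e < f z"
  then have "e < Liminf (at z) f"
    using assms(1) unfolding lower_semicontinuous_def by (metis less_le_trans)
  then have "\<forall>\<^sub>F t in at z. e < f t"
    by (simp add: less_LiminfD)
  \<comment> \<open>The punctured filter \<open>at z\<close> says nothing about z itself, yet the
    sequence may hit z; \<open>e < f z\<close> fills this gap.\<close>
  then have "\<forall>\<^sub>F t in nhds z. e < f t"
    using e by (auto simp: eventually_at_filter elim: eventually_mono)
  then have "\<forall>\<^sub>F k in sequentially. e < f (X k)"
    using assms(2) by (auto simp: filterlim_iff)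
  then have "\<forall>\<^sub>F k in sequentially. e \<le> f (X k)"
    by (rule eventually_mono) simp
  then show "e \<le> c"
    by (rule tendsto_lowerbound[OF assms(3)]) simp
qed

section \<open>Lagrangian and duality\<close>

text \<open>The Lagrangian without f. It is real-valued and linear in the multiplier, so
  extended-real arithmetic is confined to the values of f.\<close>

definition constraint_pairing ::
  "real^'n^'m1 \<Rightarrow> real^'m1 \<Rightarrow> (real^'n \<Rightarrow> real^'m2) \<Rightarrow> real^'n \<Rightarrow>
   (real^'m1) \<times> (real^'m2) \<Rightarrow> real" where
  "constraint_pairing A b g z y = fst y \<bullet> (A *v z - b) + snd y \<bullet> g z"

lemma perturbed_objective_ge_pairing:
  assumes "f z \<noteq> - \<infinity>" "0 \<le> snd y"
  shows "f z + ereal (constraint_pairing A b g z y) \<le> perturbed_objective f A b g z u - ereal (u \<bullet> y)"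
proof (cases "A *v z - b + fst u = 0 \<and> g z + snd u \<le> 0")
  case True
  have "snd y \<bullet> (g z + snd u) \<le> 0"
    using True assms by (intro inner_nonpos_vec) auto
  moreover have "fst y \<bullet> (A *v z - b + fst u) = 0"
    using True by simp
  ultimately have "constraint_pairing A b g z y \<le> - (u \<bullet> y)"
    by (simp add: constraint_pairing_def inner_prod_def inner_add_right inner_commute)
  then show ?thesis
    using True assms by (cases "f z") (auto simp: perturbed_objective_def)
next
  case False
  then have "perturbed_objective f A b g z u = \<infinity>"
    unfolding perturbed_objective_def by (rule if_not_P)
  then show ?thesis
    by simp
qed

text \<open>The perturbation making every constraint tight attains the bound of
  \<open>perturbed_objective_ge_pairing\<close>. No sign of the multiplier enters, so it bounds the
  Lagrangian above even before a saddle multiplier is known to be nonnegative.\<close>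

lemma perturbed_objective_eq_pairing:
  "perturbed_objective f A b g z (b - A *v z, - g z) - ereal ((b - A *v z, - g z) \<bullet> y)
    = f z + ereal (constraint_pairing A b g z y)"
proof -
  have "(b - A *v z, - g z) \<bullet> y = - constraint_pairing A b g z y"
    by (simp add: constraint_pairing_def inner_prod_def inner_commute inner_diff_right)
  then show ?thesis
    by (simp add: perturbed_objective_def) (simp add: minus_ereal_def)
qed

lemma lagrangian_eq:
  assumes "f z \<noteq> - \<infinity>" "0 \<le> snd y"
  shows "lagrangian f A b g z y = f z + ereal (constraint_pairing A b g z y)"
  unfolding lagrangian_def
  by (rule INF_eqI)
    (use perturbed_objective_ge_pairing[of f z y] perturbed_objective_eq_pairing[of f A b g z y] assms
      in \<open>auto, metis\<close>)

lemma lagrangian_le: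
  "lagrangian f A b g z y \<le> f z + ereal (constraint_pairing A b g z y)"
  unfolding lagrangian_def perturbed_objective_eq_pairing[symmetric] by (rule INF_lower) simp

lemma lagrangian_le_perturbed:
  "lagrangian f A b g z y \<le> perturbed_objective f A b g z u - ereal (u \<bullet> y)"
  unfolding lagrangian_def by (rule INF_lower) simp

lemma dual_perturbed_objective_le:
  "dual_perturbed_objective f A b g p y
    \<le> perturbed_objective f A b g z u - ereal (z \<bullet> p) - ereal (u \<bullet> y)"
  unfolding dual_perturbed_objective_def by (rule INF_lower2[of "(z, u)"]) auto

lemma dual_perturbed_objective_ge:
  fixes f :: "real^'n \<Rightarrow> ereal" and A :: "real^'n^'m1" and g :: "real^'n \<Rightarrow> real^'m2"
  assumes "\<And>z. f z \<noteq> - \<infinity>" "0 \<le> snd y"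
    and bound: "\<And>z. ereal (c + z \<bullet> p) \<le> f z + ereal (constraint_pairing A b g z y)"
  shows "ereal c \<le> dual_perturbed_objective f A b g p y"
  unfolding dual_perturbed_objective_def
proof (rule INF_greatest, clarify)
  fix z and s :: "real^'m1" and r :: "real^'m2"
  have "ereal (c + z \<bullet> p) \<le> perturbed_objective f A b g z (s, r) - ereal ((s, r) \<bullet> y)"
    by (rule order_trans[OF bound perturbed_objective_ge_pairing]) (use assms in auto)
  then show "ereal c \<le> perturbed_objective f A b g z (s, r) - ereal (z \<bullet> p) - ereal ((s, r) \<bullet> y)"
    by (cases "perturbed_objective f A b g z (s, r)") auto
qed

text \<open>For v the value of f at a feasible point, this is dual optimality of q with zero duality
  gap. Stating it for each z instead of through an infimum makes it stable under limits in
  q.\<close>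

definition dual_certificate ::
  "(real^'n \<Rightarrow> ereal) \<Rightarrow> real^'n^'m1 \<Rightarrow> real^'m1 \<Rightarrow> (real^'n \<Rightarrow> real^'m2) \<Rightarrow>
   real \<Rightarrow> (real^'m1) \<times> (real^'m2) \<Rightarrow> bool" where
  "dual_certificate f A b g v q \<longleftrightarrow>
    0 \<le> snd q \<and> (\<forall>z. ereal v \<le> f z + ereal (constraint_pairing A b g z q))"

text \<open>Comparison with a point of the domain of f bounds the saddle value above, and comparison
  with the multiplier 0 bounds it below. Once it is finite, feasibility of \<open>xs\<close> follows
  because the Lagrangian stays bounded above along every ray of admissible multipliers, and the sign
  of \<open>ys\<close> follows by testing perturbations.\<close>

lemma saddle_pointE:
  fixes f :: "real^'n \<Rightarrow> ereal" and A :: "real^'n^'m1" and g :: "real^'n \<Rightarrow> real^'m2"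
  assumes saddle: "(xs, ys) \<in> lagrangian_subdifferential_inv f A b g 0 0" and proper: "proper_fun f"
  obtains v where "f xs = ereal v" "A *v xs = b" "g xs \<le> 0" "dual_certificate f A b g v ys"
proof -
  have "(0, 0) \<in> lagrangian_subdifferential f A b g xs ys"
    using saddle by (simp add: lagrangian_subdifferential_inv_def)
  then have min: "lagrangian f A b g xs ys \<le> lagrangian f A b g z ys"
    and max: "lagrangian f A b g xs q \<le> lagrangian f A b g xs ys" for z q
    unfolding lagrangian_subdifferential_def mem_Collect_eq split_conv inner_zero_left
    by (simp_all del: split_paired_All flip: zero_ereal_def)
  have f_not_minf: "f z \<noteq> - \<infinity>" for z
    using proper by (simp add: proper_fun_def)
  obtain z0 where "f z0 < \<infinity>"
    using proper by (auto simp: proper_fun_def)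
  then have fin: "lagrangian f A b g xs ys < \<infinity>"
    using min[of z0] lagrangian_le[of f A b g z0 ys] by (cases "f z0") (auto simp: order_le_less_trans)
  have "f xs \<noteq> \<infinity>"
  proof
    assume "f xs = \<infinity>"
    then have "perturbed_objective f A b g xs u = \<infinity>" for u
      by (simp add: perturbed_objective_def)
    then have "lagrangian f A b g xs ys = \<infinity>"
      by (simp add: lagrangian_def)
    with fin show False
      by simp
  qed
  with f_not_minf[of xs] obtain v where v: "f xs = ereal v"
    by (cases "f xs") auto
  have L0: "lagrangian f A b g xs 0 = ereal v"
    using lagrangian_eq[of f xs 0] by (simp add: v constraint_pairing_def)
  with max[of 0] fin obtain a where a: "lagrangian f A b g xs ys = ereal a"
    by (cases "lagrangian f A b g xs ys") auto
  have pairing_nonpos: "constraint_pairing A b g xs q \<le> 0" if "0 \<le> snd q" for q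
  proof (rule ccontr)
    assume pos: "\<not> ?thesis"
    define c where "c = constraint_pairing A b g xs q"
    \<comment> \<open>Scaling q by this t gives the Lagrangian the value a + 1, above its maximum
      a.\<close>
    define t where "t = (a - v + 1) / c"
    have "0 < c" "v \<le> a"
      using pos max[of 0] by (simp_all add: c_def L0 a)
    then have t: "0 \<le> t" "t * c = a - v + 1"
      by (simp_all add: t_def)
    have "0 \<le> snd (t *\<^sub>R q)"
      using that t by (simp add: less_eq_vec_def)
    then have "lagrangian f A b g xs (t *\<^sub>R q) = ereal (v + t * c)"
      by (subst lagrangian_eq) (auto simp: v c_def constraint_pairing_def algebra_simps)
    with max[of "t *\<^sub>R q"] t show False
      by (simp add: a)
  qed
  \<comment> \<open>The residual serves as its own multiplier, which makes the pairing its squared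
    norm.\<close>
  have feasible_eq: "A *v xs = b"
    using pairing_nonpos[of "(A *v xs - b, 0)"]
    by (simp add: constraint_pairing_def flip: power2_norm_eq_inner)
  have feasible_le: "g xs \<le> 0"
  proof -
    have "g xs $ i \<le> 0" for i
    proof -
      have "0 \<le> (axis i 1 :: real^'m2)"
        by (simp add: less_eq_vec_def axis_def)
      then show ?thesis
        using pairing_nonpos[of "(0, axis i 1)"] by (simp add: constraint_pairing_def inner_axis')
    qed
    then show ?thesis
      by (simp add: less_eq_vec_def)
  qed
  \<comment> \<open>The multiplier 0 gives \<open>v \<le> a\<close>; the zero perturbation, by now
    feasible, gives \<open>a \<le> v\<close>.\<close>
  have "a = v"
    using max[of 0] lagrangian_le_perturbed[of f A b g xs ys 0] feasible_eq feasible_le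
    by (simp add: L0 a v perturbed_objective_def)
  have ys_nonneg: "0 \<le> snd ys"
  proof -
    have "0 \<le> snd ys $ i" for i
    proof -
      \<comment> \<open>This perturbation stays admissible and yields the value
        \<open>v + snd ys $ i\<close>, which cannot lie below the infimum v.\<close>
      have "g xs + - axis i 1 \<le> 0"
        using feasible_le by (auto simp: less_eq_vec_def axis_def intro: order_trans)
      then show ?thesis
        using lagrangian_le_perturbed[of f A b g xs ys "(0, - axis i 1)"] feasible_eq
        by (simp add: a v \<open>a = v\<close> perturbed_objective_def inner_prod_def inner_axis')
    qed
    then show ?thesis
      by (simp add: less_eq_vec_def)
  qed
  have "dual_certificate f A b g v ys"
    using min ys_nonneg f_not_minf by (simp add: dual_certificate_def a \<open>a = v\<close> lagrangian_eq)
  with that v feasible_eq feasible_le show thesis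
    by blast
qed

section \<open>One iteration\<close>

text \<open>If the sum is nonnegative it is at most \<open>max 0 \<alpha> + \<beta>\<close>;
  otherwise the left side is 0. The right side is the quadratic upper model of the squared positive
  part at \<alpha>, with slope \<open>2 * max 0 \<alpha>\<close>.\<close>

lemma max_add_sq_le: "(max 0 (\<alpha> + \<beta>))\<^sup>2 \<le> (max 0 \<alpha> + \<beta>)\<^sup>2" for \<alpha> \<beta> :: real
  by (cases "0 \<le> \<alpha> + \<beta>") (auto simp: max_def intro!: power_mono)

text \<open>Componentwise, \<mu>' is the positive part of \<mu> + \<sigma> c and the residual is its
  negative part divided by \<sigma>. Sign and complementarity are those of the two parts; the last
  identity matches the multiplier step with the min term of the error criterion.\<close>

lemma multiplier_update_residual:
  fixes \<mu> c :: "real^'m"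
  assumes "0 < \<sigma>"
  defines "\<mu>' \<equiv> vmax 0 (\<mu> + \<sigma> *\<^sub>R c)"
  shows "0 \<le> \<mu>'" "c + (1 / \<sigma>) *\<^sub>R (\<mu> - \<mu>') \<le> 0" "\<mu>' \<bullet> (c + (1 / \<sigma>) *\<^sub>R (\<mu> - \<mu>')) = 0"
    "\<mu> - \<mu>' = vmin \<mu> (- (\<sigma> *\<^sub>R c))"
proof -
  have residual: "c $ i + (\<mu> $ i - \<mu>' $ i) / \<sigma> = min 0 (\<mu> $ i + \<sigma> * c $ i) / \<sigma>" for i
    using assms(1) by (auto simp: \<mu>'_def vmax_def field_simps min_def max_def)
  show "0 \<le> \<mu>'"
    by (simp add: \<mu>'_def vmax_def less_eq_vec_def)
  show "c + (1 / \<sigma>) *\<^sub>R (\<mu> - \<mu>') \<le> 0"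
    using assms(1) residual by (simp add: less_eq_vec_def divide_nonpos_pos)
  show "\<mu>' \<bullet> (c + (1 / \<sigma>) *\<^sub>R (\<mu> - \<mu>')) = 0"
  proof -
    have "\<mu>' $ i * (c $ i + (\<mu> $ i - \<mu>' $ i) / \<sigma>) = 0" for i
      unfolding residual by (auto simp: \<mu>'_def vmax_def max_def min_def)
    then have "(\<Sum>i\<in>UNIV. \<mu>' $ i * (c $ i + (\<mu> $ i - \<mu>' $ i) / \<sigma>)) = 0"
      by (intro sum.neutral ballI)
    then show ?thesis
      by (simp add: inner_vec_def)
  qed
  show "\<mu> - \<mu>' = vmin \<mu> (- (\<sigma> *\<^sub>R c))"
    by (auto simp: vec_eq_iff \<mu>'_def vmax_def vmin_def min_def max_def)
qed

text \<open>
  Along a segment issuing from \<open>x\<close> the smooth part of the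
  augmented Lagrangian is bounded above by its value at \<open>x\<close>, plus the increment of the pairing with
  the updated multiplier, plus a term quadratic in the step length.
\<close>

lemma augmented_lagrangian_subgradient:
  fixes f :: "real^'n \<Rightarrow> ereal" and A :: "real^'n^'m1" and g :: "real^'n \<Rightarrow> real^'m2"
  assumes proper: "proper_fun f" and convex: "convex_ereal_fun f"
    and g_convex: "\<And>i. convex_on UNIV (\<lambda>z. g z $ i)" and \<sigma>: "0 < \<sigma>"
    and sub: "v \<in> subdifferential (\<lambda>z. augmented_lagrangian f A b g \<sigma> z l \<mu>) x"
  defines "q \<equiv> (l + \<sigma> *\<^sub>R (A *v x - b), vmax 0 (\<mu> + \<sigma> *\<^sub>R g x))"
  obtains a where "f x = ereal a"
    and "\<And>z. ereal (a + constraint_pairing A b g x q + v \<bullet> (z - x))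
              \<le> f z + ereal (constraint_pairing A b g z q)"
proof -
  define \<Phi> where "\<Phi> z = l \<bullet> (A *v z - b) + \<sigma> / 2 * (norm (A *v z - b))\<^sup>2
    + 1 / (2 * \<sigma>) * (norm (vmax 0 (\<mu> + \<sigma> *\<^sub>R g z)))\<^sup>2 - 1 / (2 * \<sigma>) * (norm \<mu>)\<^sup>2" for z
  have sub': "f x + ereal (\<Phi> x) + ereal (v \<bullet> (z - x)) \<le> f z + ereal (\<Phi> z)" for z
    using sub by (simp add: subdifferential_def augmented_lagrangian_def \<Phi>_def)
  have f_not_minf: "f z \<noteq> - \<infinity>" for z
    using proper by (simp add: proper_fun_def)
  obtain z0 where z0: "f z0 < \<infinity>"
    using proper by (auto simp: proper_fun_def)
  have "f x \<noteq> \<infinity>"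
    using sub'[of z0] z0 by auto
  with f_not_minf[of x] obtain a where a: "f x = ereal a"
    by (cases "f x") auto
  have "ereal (a + constraint_pairing A b g x q + v \<bullet> (z - x))
      \<le> f z + ereal (constraint_pairing A b g z q)" for z
  proof (cases "f z")
    case (real c)
    define \<mu>' where "\<mu>' = vmax 0 (\<mu> + \<sigma> *\<^sub>R g x)"
    define e where "e = A *v x - b"
    define d where "d = A *v (z - x)"
    define \<delta> where "\<delta> = g z - g x"
    \<comment> \<open>The first term is the exact second-order part of the penalty on the
      equalities; the second is \<open>(t * \<sigma>)\<^sup>2 / (2 * \<sigma>)\<close> from the
      model of the positive part, with \<open>t\<^sup>2\<close> factored out.\<close>
    define K where "K = \<sigma> / 2 * (norm d)\<^sup>2 + \<sigma> / 2 * (norm \<delta>)\<^sup>2"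
    have pairing: "constraint_pairing A b g z q - constraint_pairing A b g x q
        = (l + \<sigma> *\<^sub>R e) \<bullet> d + \<mu>' \<bullet> \<delta>"
      by (simp add: constraint_pairing_def q_def \<mu>'_def e_def d_def \<delta>_def algebra_simps
          matrix_vector_mult_diff_distrib)
    \<comment> \<open>This is the target inequality in real terms. It is the first-order part in t
      of the subgradient inequality of the augmented Lagrangian at x + t (z - x).\<close>
    have "0 \<le> c - a + (l + \<sigma> *\<^sub>R e) \<bullet> d + \<mu>' \<bullet> \<delta> - v \<bullet> (z - x)"
    proof (rule nonneg_of_linear_plus_quadratic[of _ K])
      fix t :: real
      assume t: "0 < t" "t < 1"
      define zt where "zt = (1 - t) *\<^sub>R x + t *\<^sub>R z"
      have zt: "zt - x = t *\<^sub>R (z - x)"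
        by (simp add: zt_def algebra_simps)
      have Azt: "A *v zt - b = e + t *\<^sub>R d"
        by (simp add: zt_def e_def d_def algebra_simps matrix_vector_mult_diff_distrib
            matrix_vector_mult_scaleR matrix_vector_mult_add_rdistrib matrix_vector_right_distrib)
      have fzt: "f zt \<le> ereal ((1 - t) * a + t * c)"
      proof -
        have "f zt \<le> ereal (1 - t) * f x + ereal t * f z"
          using convex t unfolding convex_ereal_fun_def zt_def by simp
        then show ?thesis
          by (simp add: a real)
      qed
      \<comment> \<open>Convexity of each component of g and monotonicity of the squared positive
        part reduce the claim to \<open>max_add_sq_le\<close> with increment t \<sigma>
        \<delta>.\<close>
      have "(vmax 0 (\<mu> + \<sigma> *\<^sub>R g zt) $ i)\<^sup>2 \<le> ((\<mu>' + (t * \<sigma>) *\<^sub>R \<delta>) $ i)\<^sup>2" for i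
      proof -
        have "g zt $ i \<le> (1 - t) * g x $ i + t * g z $ i"
          using convex_onD[OF g_convex[of i], of t x z] t by (simp add: zt_def)
        then have "\<sigma> * g zt $ i \<le> \<sigma> * ((1 - t) * g x $ i + t * g z $ i)"
          using \<sigma> by simp
        then have "\<mu> $ i + \<sigma> * g zt $ i \<le> (\<mu> $ i + \<sigma> * g x $ i) + t * \<sigma> * \<delta> $ i"
          by (simp add: \<delta>_def algebra_simps)
        then have "(max 0 (\<mu> $ i + \<sigma> * g zt $ i))\<^sup>2
            \<le> (max 0 ((\<mu> $ i + \<sigma> * g x $ i) + t * \<sigma> * \<delta> $ i))\<^sup>2"
          by (intro power_mono) auto
        also have "\<dots> \<le> (max 0 (\<mu> $ i + \<sigma> * g x $ i) + t * \<sigma> * \<delta> $ i)\<^sup>2"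
          by (rule max_add_sq_le)
        finally show ?thesis
          by (simp add: vmax_def \<mu>'_def)
      qed
      then have "(norm (vmax 0 (\<mu> + \<sigma> *\<^sub>R g zt)))\<^sup>2 \<le> (norm (\<mu>' + (t * \<sigma>) *\<^sub>R \<delta>))\<^sup>2"
        unfolding norm_sq_vec by (intro sum_mono)
      then have "1 / (2 * \<sigma>) * (norm (vmax 0 (\<mu> + \<sigma> *\<^sub>R g zt)))\<^sup>2
          \<le> 1 / (2 * \<sigma>) * (norm (\<mu>' + (t * \<sigma>) *\<^sub>R \<delta>))\<^sup>2"
        using \<sigma> by (intro mult_left_mono) auto
      also have "\<dots> = 1 / (2 * \<sigma>) * (norm \<mu>')\<^sup>2 + t * (\<mu>' \<bullet> \<delta>) + t\<^sup>2 * (\<sigma> / 2 * (norm \<delta>)\<^sup>2)"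
        unfolding norm_sq_add_scaleR using \<sigma> by (simp add: field_simps power2_eq_square)
      finally have max_part: "1 / (2 * \<sigma>) * (norm (vmax 0 (\<mu> + \<sigma> *\<^sub>R g zt)))\<^sup>2 \<le> \<dots>" .
      have "l \<bullet> (e + t *\<^sub>R d) + \<sigma> / 2 * (norm (e + t *\<^sub>R d))\<^sup>2
          = l \<bullet> e + \<sigma> / 2 * (norm e)\<^sup>2 + t * ((l + \<sigma> *\<^sub>R e) \<bullet> d) + t\<^sup>2 * (\<sigma> / 2 * (norm d)\<^sup>2)"
        unfolding norm_sq_add_scaleR by (simp add: algebra_simps inner_commute)
      then have \<Phi>_le: "\<Phi> zt \<le> \<Phi> x + t * ((l + \<sigma> *\<^sub>R e) \<bullet> d + \<mu>' \<bullet> \<delta>) + t\<^sup>2 * K"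
        using max_part unfolding \<Phi>_def Azt K_def
        by (simp add: e_def[symmetric] \<mu>'_def[symmetric] algebra_simps add_divide_distrib)
      obtain ft where ft: "f zt = ereal ft"
        using f_not_minf[of zt] fzt by (cases "f zt") auto
      have "a + \<Phi> x + t * (v \<bullet> (z - x)) \<le> ft + \<Phi> zt"
        using sub'[of zt] by (simp add: a ft zt)
      moreover have "ft \<le> (1 - t) * a + t * c"
        using fzt by (simp add: ft)
      ultimately show "0 \<le> t * (c - a + (l + \<sigma> *\<^sub>R e) \<bullet> d + \<mu>' \<bullet> \<delta> - v \<bullet> (z - x)) + t\<^sup>2 * K"
        using \<Phi>_le by (simp add: algebra_simps)
    qed
    then show ?thesis
      using pairing by (simp add: real)
  qed (use f_not_minf in auto)
  with that a show thesis
    by blast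
qed

text \<open>Each inner product in the monotonicity inequality, times 2 \<sigma>, is rewritten as a
  difference of squared distances. The same \<tau> stands on both sides; its change between
  iterations is accounted for in \<open>energy_decrease\<close>.\<close>

lemma fejer_step:
  fixes x x' xs w w' d p :: "real^'n" and y y' q u :: "'e::real_inner"
  assumes S: "sym_pos_def S" and \<sigma>: "0 < \<sigma>"
    and p: "p = d - (\<tau> / \<sigma>) *\<^sub>R (S *v (x' - x))" and u: "u = (1 / \<sigma>) *\<^sub>R (y - y')"
    and w': "w' = w - \<sigma> *\<^sub>R d"
    and mono: "0 \<le> p \<bullet> (x' - xs) + u \<bullet> (y' - q)"
    and crit: "2 * \<bar>(w - x') \<bullet> (\<sigma> *\<^sub>R d)\<bar> + (norm (\<sigma> *\<^sub>R d))\<^sup>2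
      \<le> \<rho> * ((norm (y - y'))\<^sup>2 + \<tau> * ((x' - x) \<bullet> (S *v (x' - x))))"
  shows "(norm (w' - xs))\<^sup>2 + (norm (y' - q))\<^sup>2 + \<tau> * ((x' - xs) \<bullet> (S *v (x' - xs)))
      + (1 - \<rho>) * ((norm (y - y'))\<^sup>2 + \<tau> * ((x' - x) \<bullet> (S *v (x' - x))))
    \<le> (norm (w - xs))\<^sup>2 + (norm (y - q))\<^sup>2 + \<tau> * ((x - xs) \<bullet> (S *v (x - xs)))"
proof -
  define D where "D = \<sigma> *\<^sub>R d"
  have "0 \<le> 2 * \<sigma> * (p \<bullet> (x' - xs) + u \<bullet> (y' - q))"
    using mono \<sigma> by simp
  also have "\<dots> = 2 * ((\<sigma> *\<^sub>R p) \<bullet> (x' - xs)) + 2 * ((\<sigma> *\<^sub>R u) \<bullet> (y' - q))"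
    by (simp add: algebra_simps)
  also have "\<sigma> *\<^sub>R p = D - \<tau> *\<^sub>R (S *v (x' - x))"
    using \<sigma> by (simp add: p D_def algebra_simps)
  also have "\<sigma> *\<^sub>R u = y - y'"
    using \<sigma> by (simp add: u)
  finally have sum: "0 \<le> 2 * (D \<bullet> (x' - xs)) - \<tau> * (2 * ((x' - xs) \<bullet> (S *v (x' - x))))
      + 2 * ((y - y') \<bullet> (y' - q))"
    by (simp add: inner_diff_left inner_commute algebra_simps)
  have y_id: "2 * ((y - y') \<bullet> (y' - q)) = (norm (y - q))\<^sup>2 - (norm (y' - q))\<^sup>2 - (norm (y - y'))\<^sup>2"
    by (simp add: power2_norm_eq_inner algebra_simps inner_commute)
  have x_id: "2 * ((x' - xs) \<bullet> (S *v (x' - x))) = (x' - xs) \<bullet> (S *v (x' - xs))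
      + (x' - x) \<bullet> (S *v (x' - x)) - (x - xs) \<bullet> (S *v (x - xs))"
    using sym_pos_def_commute[OF S, of x' x] sym_pos_def_commute[OF S, of x' xs]
      sym_pos_def_commute[OF S, of x xs]
    by (simp add: matrix_vector_mult_diff_distrib algebra_simps)
  have w_id: "2 * (D \<bullet> (x' - xs)) = (norm (w - xs))\<^sup>2 - (norm (w' - xs))\<^sup>2 + (norm D)\<^sup>2
      - 2 * ((w - x') \<bullet> D)"
    by (simp add: w' D_def[symmetric] power2_norm_eq_inner algebra_simps inner_commute)
  \<comment> \<open>The cross term may have either sign, which the absolute value in the criterion
    covers.\<close>
  have "(norm D)\<^sup>2 - 2 * ((w - x') \<bullet> D)
      \<le> \<rho> * ((norm (y - y'))\<^sup>2 + \<tau> * ((x' - x) \<bullet> (S *v (x' - x))))"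
    using crit unfolding D_def[symmetric] by (smt (verit))
  with sum y_id w_id show ?thesis
    unfolding x_id by (simp add: algebra_simps)
qed

section \<open>Convergence of null sequences and cluster points\<close>

lemma tendsto_zero_of_norm_sq:
  assumes "0 < c" "\<And>k. c * (norm (X k))\<^sup>2 \<le> r k" "r \<longlonglongrightarrow> 0"
  shows "X \<longlonglongrightarrow> 0"
proof -
  have "(\<lambda>k. (norm (X k))\<^sup>2) \<longlonglongrightarrow> 0"
  proof (rule Lim_null_comparison)
    show "(\<lambda>k. r k / c) \<longlonglongrightarrow> 0"
      using tendsto_divide[OF assms(3) tendsto_const, of c] assms(1) by simp
    show "\<forall>\<^sub>F k in sequentially. norm ((norm (X k))\<^sup>2) \<le> r k / c"
      using assms(1,2) by (simp add: field_simps)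
  qed
  then have "(\<lambda>k. sqrt ((norm (X k))\<^sup>2)) \<longlonglongrightarrow> sqrt 0"
    by (rule tendsto_real_sqrt)
  then show ?thesis
    by (simp add: tendsto_norm_zero_iff)
qed

lemma bounded_range_of_norm_sq:
  assumes "0 < c" "\<And>k. c * (norm (X k - a))\<^sup>2 \<le> B"
  shows "bounded (range X)"
proof -
  have "dist a (X k) \<le> sqrt (B / c)" for k
    using assms(1) assms(2)[of k]
    by (intro real_le_rsqrt) (simp add: dist_norm norm_minus_commute field_simps)
  then show ?thesis
    by (auto simp: bounded_def)
qed

lemma tendsto_inner_zero_bounded:
  assumes "X \<longlonglongrightarrow> 0" "bounded (range Y)"
  shows "(\<lambda>k. X k \<bullet> Y k) \<longlonglongrightarrow> 0"
proof -
  obtain B where B: "norm (Y k) \<le> B" for k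
    using assms(2) by (auto simp: bounded_iff)
  show ?thesis
  proof (rule Lim_null_comparison)
    show "\<forall>\<^sub>F k in sequentially. norm (X k \<bullet> Y k) \<le> norm (X k) * B"
      by (intro always_eventually allI)
        (metis B Cauchy_Schwarz_ineq2 mult_left_mono norm_ge_zero order_trans real_norm_def)
    show "(\<lambda>k. norm (X k) * B) \<longlonglongrightarrow> 0"
      using assms(1) by (intro tendsto_mult_left_zero tendsto_norm_zero)
  qed
qed

lemma convergent_bounded_above:
  fixes a :: "nat \<Rightarrow> real"
  assumes "convergent a"
  obtains B where "\<And>k. a k \<le> B"
proof -
  have "bounded (range a)"
    using assms convergent_imp_bounded by (auto simp: convergent_def)
  then obtain B where "\<bar>a k\<bar> \<le> B" for k
    by (auto simp: bounded_iff)
  then show thesis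
    using that by (meson abs_le_D1)
qed

lemma bounded_range_Suc: "bounded (range X) \<Longrightarrow> bounded (range (\<lambda>k. X (Suc k)))"
  by (rule bounded_subset) auto

text \<open>The estimates concern iterates with positive index. Dropping the first term of the
  subsequence makes every index positive, hence a successor.\<close>

lemma accumulation_point_SucE:
  assumes "accumulation_point X a"
  obtains s where "strict_mono s" "(\<lambda>j. X (Suc (s j))) \<longlonglongrightarrow> a"
proof -
  obtain r where r: "strict_mono r" "(X \<circ> r) \<longlonglongrightarrow> a"
    using assms by (auto simp: accumulation_point_def)
  have pos: "0 < r (Suc j)" for j
    using strict_monoD[OF r(1), of 0 "Suc j"] by simp
  show thesis
  proof
    show "strict_mono (\<lambda>j. r (Suc j) - 1)"
      using strict_monoD[OF r(1)] pos by (intro strict_monoI diff_less_mono) (auto simp: Suc_leI)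
    show "(\<lambda>j. X (Suc (r (Suc j) - 1))) \<longlonglongrightarrow> a"
      using LIMSEQ_Suc[OF r(2)] pos by simp
  qed
qed

lemma bounded_accumulation_point:
  fixes X :: "nat \<Rightarrow> 'a::heine_borel"
  assumes "bounded (range X)"
  obtains a where "accumulation_point X a"
  using bounded_imp_convergent_subsequence[OF assms] by (auto simp: accumulation_point_def)

text \<open>Otherwise infinitely many terms stay at distance at least e from a; a cluster point of
  those terms would be a cluster point of the sequence other than a.\<close>

lemma LIMSEQ_unique_accumulation_point:
  fixes X :: "nat \<Rightarrow> 'a::heine_borel"
  assumes bounded: "bounded (range X)" and unique: "\<And>c. accumulation_point X c \<Longrightarrow> c = a"
  shows "X \<longlonglongrightarrow> a"
proof (rule ccontr)
  assume "\<not> ?thesis"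
  then obtain e where e: "0 < e" "\<not> (\<forall>\<^sub>F k in sequentially. dist (X k) a < e)"
    by (auto simp: tendsto_iff)
  then have inf: "infinite {k. e \<le> dist (X k) a}"
    by (simp add: cofinite_eq_sequentially[symmetric] eventually_cofinite not_less)
  define r where "r = enumerate {k. e \<le> dist (X k) a}"
  have r: "strict_mono r" "e \<le> dist (X (r k)) a" for k
    using strict_mono_enumerate[OF inf] enumerate_in_set[OF inf, of k] by (auto simp: r_def)
  have "bounded (range (X \<circ> r))"
    using bounded by (rule bounded_subset) auto
  then obtain c r' where r': "strict_mono r'" "((X \<circ> r) \<circ> r') \<longlonglongrightarrow> c"
    using bounded_imp_convergent_subsequence by blast
  then have "accumulation_point X c"
    using strict_mono_o[OF r(1) r'(1)] by (auto simp: accumulation_point_def o_assoc)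
  then have "((X \<circ> r) \<circ> r') \<longlonglongrightarrow> a"
    using unique r' by blast
  then have "\<forall>\<^sub>F k in sequentially. dist (((X \<circ> r) \<circ> r') k) a < e"
    using e(1) by (rule tendstoD)
  then show False
    using r(2) by (auto simp: eventually_sequentially not_less[symmetric])
qed

section \<open>Convergence of the iterates\<close>

text \<open>The saddle point enters only through feasibility and value of \<open>xs\<close> and the
  certificate of \<open>ys\<close>. Other dual points carrying a certificate can then take the place
  of \<open>ys\<close>.\<close>

locale rip2ALM_run =
  fixes f :: "real^'n \<Rightarrow> ereal"
    and A :: "real^'n^'m1" and b :: "real^'m1"
    and g :: "real^'n \<Rightarrow> real^'m2"
    and S :: "real^'n^'n"
    and \<rho> \<sigma>min \<tau>min :: real
    and \<sigma> \<tau> \<nu> :: "nat \<Rightarrow> real"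
    and x \<Delta> w p :: "nat \<Rightarrow> real^'n"
    and l :: "nat \<Rightarrow> real^'m1" and \<mu> :: "nat \<Rightarrow> real^'m2"
    and y u :: "nat \<Rightarrow> (real^'m1) \<times> (real^'m2)"
    and xs :: "real^'n" and v :: real and ys :: "(real^'m1) \<times> (real^'m2)"
  assumes proper: "proper_fun f" and lsc: "lower_semicontinuous f" and f_convex: "convex_ereal_fun f"
    and g_convex: "\<And>i. convex_on UNIV (\<lambda>z. g z $ i)"
    and \<rho>_less_1: "\<rho> < 1" and S: "sym_pos_def S"
    and \<sigma>min_pos: "0 < \<sigma>min" and \<sigma>min_le: "\<And>k. \<sigma>min \<le> \<sigma> k"
    and \<tau>min_pos: "0 < \<tau>min" and \<tau>min_le: "\<And>k. \<tau>min \<le> \<tau> k"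
    and \<tau>_step: "\<And>k. \<tau> (Suc k) \<le> (1 + \<nu> k) * \<tau> k"
    and \<nu>_nonneg: "\<And>k. 0 \<le> \<nu> k" and \<nu>_summable: "summable \<nu>"
    and run: "rip2ALM f A b g \<rho> \<sigma> \<tau> S x \<Delta> w l \<mu>"
    and y_eq: "\<And>k. y k = (l k, \<mu> k)"
    and p_eq: "\<And>k. p (Suc k) = \<Delta> (Suc k) - (\<tau> k / \<sigma> k) *\<^sub>R (S *v (x (Suc k) - x k))"
    and u_eq: "\<And>k. u (Suc k) = (1 / \<sigma> k) *\<^sub>R (y k - y (Suc k))"
    and xs_value: "f xs = ereal v" and xs_eq: "A *v xs = b" and xs_le: "g xs \<le> 0"
    and ys_certificate: "dual_certificate f A b g v ys"
begin

section \<open>Feasibility and complementarity at the perturbed iterates\<close>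

lemma \<sigma>_pos: "0 < \<sigma> k"
  using \<sigma>min_pos \<sigma>min_le[of k] by linarith

lemma \<tau>_pos: "0 < \<tau> k"
  using \<tau>min_pos \<tau>min_le[of k] by linarith

lemma f_not_minf: "f z \<noteq> - \<infinity>"
  using proper by (simp add: proper_fun_def)

lemma l_Suc: "l (Suc k) = l k + \<sigma> k *\<^sub>R (A *v x (Suc k) - b)"
  and \<mu>_Suc: "\<mu> (Suc k) = vmax 0 (\<mu> k + \<sigma> k *\<^sub>R g (x (Suc k)))"
  and w_Suc: "w (Suc k) = w k - \<sigma> k *\<^sub>R \<Delta> (Suc k)"
  using run by (simp_all add: rip2ALM_def)

lemma p_subgradient:
  "p (Suc k) \<in> subdifferential (\<lambda>z. augmented_lagrangian f A b g (\<sigma> k) z (l k) (\<mu> k)) (x (Suc k))"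
proof -
  have "\<Delta> (Suc k) \<in> (\<lambda>d. d + (\<tau> k / \<sigma> k) *\<^sub>R (S *v (x (Suc k) - x k))) `
      subdifferential (\<lambda>z. augmented_lagrangian f A b g (\<sigma> k) z (l k) (\<mu> k)) (x (Suc k))"
    using run unfolding rip2ALM_def by blast
  then show ?thesis
    unfolding p_eq by force
qed

lemma y_nonneg: "0 \<le> snd (y k)"
proof (cases k)
  case 0
  then show ?thesis
    using run by (simp add: y_eq rip2ALM_def)
next
  case (Suc j)
  then show ?thesis
    using multiplier_update_residual(1)[OF \<sigma>_pos[of j]] by (simp add: y_eq \<mu>_Suc)
qed

lemma u_feasible_eq: "A *v x (Suc k) - b + fst (u (Suc k)) = 0"
  using \<sigma>_pos[of k] by (simp add: u_eq y_eq l_Suc algebra_simps)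

lemma snd_u: "snd (u (Suc k)) = (1 / \<sigma> k) *\<^sub>R (\<mu> k - \<mu> (Suc k))"
  by (simp add: u_eq y_eq)

lemma u_feasible_le: "g (x (Suc k)) + snd (u (Suc k)) \<le> 0"
  unfolding snd_u \<mu>_Suc by (rule multiplier_update_residual(2)[OF \<sigma>_pos])

lemma complementarity: "snd (y (Suc k)) \<bullet> (g (x (Suc k)) + snd (u (Suc k))) = 0"
  unfolding snd_u y_eq snd_conv \<mu>_Suc by (rule multiplier_update_residual(3)[OF \<sigma>_pos])

text \<open>\<open>u (Suc k)\<close> is the perturbation for which \<open>x (Suc k)\<close> is
  feasible. The first term on the right vanishes for \<open>y (Suc k)\<close> by complementarity and
  is nonpositive for every q with \<open>0 \<le> snd q\<close>.\<close>

lemma pairing_at_iterate: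
  "constraint_pairing A b g (x (Suc k)) q
    = snd q \<bullet> (g (x (Suc k)) + snd (u (Suc k))) - u (Suc k) \<bullet> q"
proof -
  have "A *v x (Suc k) - b = - fst (u (Suc k))"
    using u_feasible_eq[of k] by (simp add: eq_neg_iff_add_eq_0)
  then show ?thesis
    by (simp add: constraint_pairing_def inner_prod_def inner_add_right inner_commute)
qed

definition \<phi> :: "nat \<Rightarrow> real" where
  "\<phi> k = real_of_ereal (f (x (Suc k)))"

lemma f_iterate: "f (x (Suc k)) = ereal (\<phi> k)"
  and lagrangian_subgradient:
    "ereal (\<phi> k - u (Suc k) \<bullet> y (Suc k) + p (Suc k) \<bullet> (z - x (Suc k)))
      \<le> f z + ereal (constraint_pairing A b g z (y (Suc k)))"
proof -
  have y: "y (Suc k) = (l k + \<sigma> k *\<^sub>R (A *v x (Suc k) - b), vmax 0 (\<mu> k + \<sigma> k *\<^sub>R g (x (Suc k))))"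
    by (simp add: y_eq l_Suc \<mu>_Suc)
  obtain a where a: "f (x (Suc k)) = ereal a"
    and le: "\<And>z. ereal (a + constraint_pairing A b g (x (Suc k)) (y (Suc k)) + p (Suc k) \<bullet> (z - x (Suc k)))
              \<le> f z + ereal (constraint_pairing A b g z (y (Suc k)))"
    using augmented_lagrangian_subgradient[OF proper f_convex g_convex \<sigma>_pos p_subgradient[of k]]
    unfolding y by metis
  show "f (x (Suc k)) = ereal (\<phi> k)"
    by (simp add: \<phi>_def a)
  show "ereal (\<phi> k - u (Suc k) \<bullet> y (Suc k) + p (Suc k) \<bullet> (z - x (Suc k)))
      \<le> f z + ereal (constraint_pairing A b g z (y (Suc k)))"
    using le[of z] by (simp add: \<phi>_def a pairing_at_iterate complementarity)
qed

text \<open>The certificate is tested at the iterate; \<open>objective_upper\<close> tests the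
  subgradient inequality at \<open>xs\<close>. Their combination is the monotonicity inequality
  behind the energy decrease, and later the two squeeze \<phi>.\<close>

lemma objective_lower:
  assumes "dual_certificate f A b g v q"
  shows "v + u (Suc k) \<bullet> q \<le> \<phi> k"
proof -
  have "ereal v \<le> f (x (Suc k)) + ereal (constraint_pairing A b g (x (Suc k)) q)"
    using assms by (simp add: dual_certificate_def)
  moreover have "snd q \<bullet> (g (x (Suc k)) + snd (u (Suc k))) \<le> 0"
    using assms u_feasible_le by (intro inner_nonpos_vec) (auto simp: dual_certificate_def)
  ultimately show ?thesis
    by (simp add: f_iterate pairing_at_iterate)
qed

lemma pairing_at_solution: "0 \<le> snd q \<Longrightarrow> constraint_pairing A b g xs q \<le> 0"
  using xs_le by (simp add: constraint_pairing_def xs_eq inner_nonpos_vec)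

lemma objective_upper: "\<phi> k - u (Suc k) \<bullet> y (Suc k) + p (Suc k) \<bullet> (xs - x (Suc k)) \<le> v"
  using lagrangian_subgradient[of k xs] pairing_at_solution[OF y_nonneg[of "Suc k"]]
  by (simp add: xs_value)

section \<open>Energy and its quasi-Fejer decrease\<close>

definition energy :: "(real^'m1) \<times> (real^'m2) \<Rightarrow> nat \<Rightarrow> real" where
  "energy q k = (norm (w k - xs))\<^sup>2 + (norm (y k - q))\<^sup>2 + \<tau> k * ((x k - xs) \<bullet> (S *v (x k - xs)))"

definition gap :: "nat \<Rightarrow> real" where
  "gap k = (norm (y k - y (Suc k)))\<^sup>2 + \<tau> k * ((x (Suc k) - x k) \<bullet> (S *v (x (Suc k) - x k)))"

lemma quadratic_nonneg: "0 \<le> \<tau> k * (z \<bullet> (S *v z))"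
  using \<tau>_pos[of k] sym_pos_def_nonneg[OF S, of z] by simp

lemma energy_nonneg: "0 \<le> energy q k"
  using quadratic_nonneg by (simp add: energy_def)

lemma gap_nonneg: "0 \<le> gap k"
  using quadratic_nonneg by (simp add: gap_def)

text \<open>The equality residual and the min term are, up to sign, the two blocks of the multiplier
  step, so the bracket in the error criterion is exactly \<open>gap k\<close>.\<close>

lemma error_criterion:
  "2 * \<bar>(w k - x (Suc k)) \<bullet> (\<sigma> k *\<^sub>R \<Delta> (Suc k))\<bar> + (norm (\<sigma> k *\<^sub>R \<Delta> (Suc k)))\<^sup>2 \<le> \<rho> * gap k"
proof -
  have "y k - y (Suc k)
      = (- (\<sigma> k *\<^sub>R (A *v x (Suc k) - b)), vmin (\<mu> k) (- (\<sigma> k *\<^sub>R g (x (Suc k)))))"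
    unfolding multiplier_update_residual(4)[OF \<sigma>_pos, symmetric] by (simp add: y_eq l_Suc \<mu>_Suc)
  then have "(norm (y k - y (Suc k)))\<^sup>2 = (norm (\<sigma> k *\<^sub>R (A *v x (Suc k) - b)))\<^sup>2
      + (norm (vmin (\<mu> k) (- (\<sigma> k *\<^sub>R g (x (Suc k))))))\<^sup>2"
    by (simp only: norm_Pair norm_minus_cancel) simp
  then have "gap k = (norm (\<sigma> k *\<^sub>R (A *v x (Suc k) - b)))\<^sup>2
      + (norm (vmin (\<mu> k) (- (\<sigma> k *\<^sub>R g (x (Suc k))))))\<^sup>2
      + \<tau> k * (weighted_norm S (x (Suc k) - x k))\<^sup>2"
    by (simp add: gap_def weighted_norm_sq[OF S])
  then show ?thesis
    using run unfolding rip2ALM_def by metis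
qed

lemma energy_decrease:
  assumes q: "dual_certificate f A b g v q"
  shows "energy q (Suc k) + (1 - \<rho>) * gap k \<le> (1 + \<nu> k) * energy q k"
proof -
  have mono: "0 \<le> p (Suc k) \<bullet> (x (Suc k) - xs) + u (Suc k) \<bullet> (y (Suc k) - q)"
    using objective_lower[OF q, of k] objective_upper[of k] by (simp add: inner_diff_right)
  have step: "(norm (w (Suc k) - xs))\<^sup>2 + (norm (y (Suc k) - q))\<^sup>2
      + \<tau> k * ((x (Suc k) - xs) \<bullet> (S *v (x (Suc k) - xs))) + (1 - \<rho>) * gap k \<le> energy q k"
    unfolding gap_def energy_def
    by (rule fejer_step[OF S \<sigma>_pos p_eq u_eq w_Suc mono]) (use error_criterion[of k] in \<open>simp only: gap_def\<close>)
  \<comment> \<open>Only Q carries \<tau>, whose growth costs the factor 1 + \<nu> k; W is enlarged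
    by the same factor so that \<open>step\<close> bounds the whole.\<close>
  define Q where "Q = (x (Suc k) - xs) \<bullet> (S *v (x (Suc k) - xs))"
  define W where "W = (norm (w (Suc k) - xs))\<^sup>2 + (norm (y (Suc k) - q))\<^sup>2"
  have "0 \<le> Q" "0 \<le> W"
    using sym_pos_def_nonneg[OF S] by (simp_all add: Q_def W_def)
  have "energy q (Suc k) = W + \<tau> (Suc k) * Q"
    by (simp add: energy_def W_def Q_def)
  also have "\<dots> \<le> (1 + \<nu> k) * W + ((1 + \<nu> k) * \<tau> k) * Q"
    using \<open>0 \<le> Q\<close> \<open>0 \<le> W\<close> \<nu>_nonneg[of k]
    by (intro add_mono mult_right_mono \<tau>_step) (simp_all add: distrib_right)
  also have "\<dots> = (1 + \<nu> k) * (W + \<tau> k * Q)"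
    by (simp add: algebra_simps)
  also have "\<dots> \<le> (1 + \<nu> k) * (energy q k - (1 - \<rho>) * gap k)"
    using step \<nu>_nonneg[of k] by (intro mult_left_mono) (simp_all add: W_def Q_def)
  also have "\<dots> = (1 + \<nu> k) * energy q k - (1 - \<rho>) * gap k - \<nu> k * ((1 - \<rho>) * gap k)"
    by (simp add: algebra_simps)
  finally show ?thesis
    using mult_nonneg_nonneg[OF \<nu>_nonneg[of k] mult_nonneg_nonneg[of "1 - \<rho>" "gap k"]]
      \<rho>_less_1 gap_nonneg[of k] by linarith
qed

lemma energy_convergent:
  assumes "dual_certificate f A b g v q"
  shows "convergent (energy q)"
proof (rule quasi_decreasing_convergent[OF energy_nonneg _ \<nu>_nonneg \<nu>_summable])
  fix k
  have "0 \<le> (1 - \<rho>) * gap k"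
    using \<rho>_less_1 gap_nonneg by simp
  then show "energy q (Suc k) \<le> (1 + \<nu> k) * energy q k"
    using energy_decrease[OF assms, of k] by linarith
qed

text \<open>The gap is at most a multiple of the energy drop, and that drop vanishes because the
  energy converges and \<nu> tends to 0.\<close>

lemma gap_tendsto_0: "gap \<longlonglongrightarrow> 0"
proof -
  obtain E where E: "energy ys \<longlonglongrightarrow> E"
    using energy_convergent[OF ys_certificate] by (auto simp: convergent_def)
  have "(\<lambda>k. (1 + \<nu> k) * energy ys k - energy ys (Suc k)) \<longlonglongrightarrow> (1 + 0) * E - E"
    by (intro tendsto_intros E LIMSEQ_Suc[OF E] summable_LIMSEQ_zero \<nu>_summable)
  then have lim: "(\<lambda>k. ((1 + \<nu> k) * energy ys k - energy ys (Suc k)) / (1 - \<rho>)) \<longlonglongrightarrow> 0"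
    by (auto intro: tendsto_divide_zero)
  show ?thesis
  proof (rule tendsto_sandwich[OF _ _ tendsto_const lim])
    show "\<forall>\<^sub>F k in sequentially. 0 \<le> gap k"
      by (simp add: gap_nonneg)
    show "\<forall>\<^sub>F k in sequentially.
        gap k \<le> ((1 + \<nu> k) * energy ys k - energy ys (Suc k)) / (1 - \<rho>)"
    proof (intro always_eventually allI)
      fix k
      show "gap k \<le> ((1 + \<nu> k) * energy ys k - energy ys (Suc k)) / (1 - \<rho>)"
        using energy_decrease[OF ys_certificate, of k] \<rho>_less_1
        by (simp add: pos_le_divide_eq mult.commute)
    qed
  qed
qed

lemma bounded_iterates: "bounded (range x)" "bounded (range w)" "bounded (range y)"
proof -
  obtain B where B: "energy ys k \<le> B" for k
    using convergent_bounded_above[OF energy_convergent[OF ys_certificate]] by blast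
  obtain c where c: "0 < c" "\<And>z. c * (norm z)\<^sup>2 \<le> z \<bullet> (S *v z)"
    using sym_pos_def_coercive[OF S] by blast
  have w: "(norm (w k - xs))\<^sup>2 \<le> B" for k
    using B[of k] quadratic_nonneg[of k "x k - xs"] unfolding energy_def by (smt (verit) zero_le_power2)
  have y: "(norm (y k - ys))\<^sup>2 \<le> B" for k
    using B[of k] quadratic_nonneg[of k "x k - xs"] unfolding energy_def by (smt (verit) zero_le_power2)
  have x: "\<tau>min * c * (norm (x k - xs))\<^sup>2 \<le> B" for k
  proof -
    \<comment> \<open>The lower bound on \<tau> and coercivity of S turn the weighted term of the
      energy into control of the Euclidean distance.\<close>
    have "\<tau>min * (c * (norm (x k - xs))\<^sup>2) \<le> \<tau> k * ((x k - xs) \<bullet> (S *v (x k - xs)))"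
      using \<tau>min_le[of k] \<tau>_pos[of k] c by (intro mult_mono) auto
    then show ?thesis
      using B[of k] unfolding energy_def by (smt (verit) zero_le_power2 mult.assoc)
  qed
  show "bounded (range x)"
    using \<tau>min_pos c(1) x by (intro bounded_range_of_norm_sq[of "\<tau>min * c"]) auto
  show "bounded (range w)"
    using w by (intro bounded_range_of_norm_sq[of 1]) auto
  show "bounded (range y)"
    using y by (intro bounded_range_of_norm_sq[of 1]) auto
qed

section \<open>Vanishing residuals\<close>

lemma \<Delta>_tendsto_0: "(\<lambda>k. \<Delta> (Suc k)) \<longlonglongrightarrow> 0"
proof (rule tendsto_zero_of_norm_sq[OF _ _ gap_tendsto_0])
  show "0 < \<sigma>min\<^sup>2"
    using \<sigma>min_pos by simp
  fix k
  have "\<sigma>min\<^sup>2 * (norm (\<Delta> (Suc k)))\<^sup>2 \<le> (norm (\<sigma> k *\<^sub>R \<Delta> (Suc k)))\<^sup>2"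
    using \<sigma>min_pos \<sigma>min_le[of k] by (simp add: power_mult_distrib mult_right_mono power_mono)
  also have "\<dots> \<le> \<rho> * gap k"
    using error_criterion[of k] by linarith
  also have "\<dots> \<le> 1 * gap k"
    using \<rho>_less_1 gap_nonneg by (intro mult_right_mono) auto
  finally show "\<sigma>min\<^sup>2 * (norm (\<Delta> (Suc k)))\<^sup>2 \<le> gap k"
    by simp
qed

lemma x_diff_tendsto_0: "(\<lambda>k. x (Suc k) - x k) \<longlonglongrightarrow> 0"
proof -
  obtain c where c: "0 < c" "\<And>z. c * (norm z)\<^sup>2 \<le> z \<bullet> (S *v z)"
    using sym_pos_def_coercive[OF S] by blast
  show ?thesis
  proof (rule tendsto_zero_of_norm_sq[OF _ _ gap_tendsto_0])
    show "0 < \<tau>min * c"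
      using \<tau>min_pos c(1) by simp
    fix k
    have "\<tau>min * (c * (norm (x (Suc k) - x k))\<^sup>2)
        \<le> \<tau> k * ((x (Suc k) - x k) \<bullet> (S *v (x (Suc k) - x k)))"
      using \<tau>min_le[of k] \<tau>_pos[of k] c by (intro mult_mono) auto
    then show "\<tau>min * c * (norm (x (Suc k) - x k))\<^sup>2 \<le> gap k"
      unfolding gap_def by (smt (verit) zero_le_power2 mult.assoc)
  qed
qed

lemma p_tendsto_0: "(\<lambda>k. p (Suc k)) \<longlonglongrightarrow> 0"
proof -
  \<comment> \<open>The growth condition on \<tau> has the same quasi-monotone form as the energy
    inequality, which supplies the upper bound T.\<close>
  have "convergent \<tau>"
    by (rule quasi_decreasing_convergent[OF _ \<tau>_step \<nu>_nonneg \<nu>_summable]) (simp add: \<tau>_pos less_imp_le)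
  then obtain T where T: "\<tau> k \<le> T" for k
    using convergent_bounded_above by blast
  have "(\<lambda>k. S *v (x (Suc k) - x k)) \<longlonglongrightarrow> S *v 0"
    by (rule bounded_linear.tendsto[OF matrix_vector_mul_bounded_linear x_diff_tendsto_0])
  then have lim: "(\<lambda>k. T / \<sigma>min * norm (S *v (x (Suc k) - x k))) \<longlonglongrightarrow> 0"
    by (intro tendsto_mult_right_zero tendsto_norm_zero) simp
  have "(\<lambda>k. (\<tau> k / \<sigma> k) *\<^sub>R (S *v (x (Suc k) - x k))) \<longlonglongrightarrow> 0"
  proof (rule Lim_null_comparison[OF _ lim], intro always_eventually allI)
    fix k
    have "\<tau> k / \<sigma> k \<le> T / \<sigma>min"
      using \<tau>_pos[of k] \<sigma>min_pos \<sigma>min_le[of k] T[of k] by (intro frac_le) auto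
    then have "\<tau> k / \<sigma> k * norm (S *v (x (Suc k) - x k)) \<le> T / \<sigma>min * norm (S *v (x (Suc k) - x k))"
      by (rule mult_right_mono) simp
    then show "norm ((\<tau> k / \<sigma> k) *\<^sub>R (S *v (x (Suc k) - x k))) \<le> T / \<sigma>min * norm (S *v (x (Suc k) - x k))"
      using \<tau>_pos[of k] \<sigma>_pos[of k] by simp
  qed
  from tendsto_diff[OF \<Delta>_tendsto_0 this] show ?thesis
    by (simp add: p_eq)
qed

lemma u_tendsto_0: "(\<lambda>k. u (Suc k)) \<longlonglongrightarrow> 0"
proof (rule tendsto_zero_of_norm_sq[OF _ _ gap_tendsto_0])
  show "0 < \<sigma>min\<^sup>2"
    using \<sigma>min_pos by simp
  fix k
  have "y k - y (Suc k) = \<sigma> k *\<^sub>R u (Suc k)"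
    using \<sigma>_pos[of k] by (simp add: u_eq)
  then have "\<sigma>min\<^sup>2 * (norm (u (Suc k)))\<^sup>2 \<le> (norm (y k - y (Suc k)))\<^sup>2"
    using \<sigma>min_pos \<sigma>min_le[of k] by (simp add: power_mult_distrib mult_right_mono power_mono)
  then show "\<sigma>min\<^sup>2 * (norm (u (Suc k)))\<^sup>2 \<le> gap k"
    using quadratic_nonneg[of k "x (Suc k) - x k"] by (simp add: gap_def)
qed

lemma u_inner_y_tendsto_0: "(\<lambda>k. u (Suc k) \<bullet> y (Suc k)) \<longlonglongrightarrow> 0"
  and p_inner_x_tendsto_0: "(\<lambda>k. p (Suc k) \<bullet> x (Suc k)) \<longlonglongrightarrow> 0"
  by (intro tendsto_inner_zero_bounded u_tendsto_0 p_tendsto_0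
      bounded_range_Suc[OF bounded_iterates(1)] bounded_range_Suc[OF bounded_iterates(3)])+

lemma p_inner_diff_tendsto_0: "(\<lambda>k. p (Suc k) \<bullet> (z - x (Suc k))) \<longlonglongrightarrow> 0"
  using tendsto_diff[OF tendsto_inner[OF p_tendsto_0 tendsto_const, of z] p_inner_x_tendsto_0]
  by (simp add: inner_diff_right)

lemma \<phi>_tendsto: "\<phi> \<longlonglongrightarrow> v"
proof (rule tendsto_sandwich)
  show "\<forall>\<^sub>F k in sequentially. v + u (Suc k) \<bullet> ys \<le> \<phi> k"
    by (simp add: objective_lower[OF ys_certificate])
  show "\<forall>\<^sub>F k in sequentially.
      \<phi> k \<le> v + u (Suc k) \<bullet> y (Suc k) - p (Suc k) \<bullet> (xs - x (Suc k))"
    using objective_upper by (auto simp: algebra_simps intro!: always_eventually)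
  show "(\<lambda>k. v + u (Suc k) \<bullet> ys) \<longlonglongrightarrow> v"
    using tendsto_add[OF tendsto_const tendsto_inner[OF u_tendsto_0 tendsto_const], of v ys] by simp
  show "(\<lambda>k. v + u (Suc k) \<bullet> y (Suc k) - p (Suc k) \<bullet> (xs - x (Suc k))) \<longlonglongrightarrow> v"
    using tendsto_diff[OF tendsto_add[OF tendsto_const u_inner_y_tendsto_0]
        p_inner_diff_tendsto_0, of v xs]
    by simp
qed

section \<open>Primal and dual values\<close>

lemma primal_value_at_iterate: "perturbed_objective f A b g (x (Suc k)) (u (Suc k)) = ereal (\<phi> k)"
  using u_feasible_eq u_feasible_le by (simp add: perturbed_objective_def f_iterate)

text \<open>The infimum defining G is attained at \<open>(x (Suc k), u (Suc k))\<close>: the affine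
  minorant from \<open>lagrangian_subgradient\<close> is exactly the lower bound needed. This is
  equality in the Fenchel-Young inequality for F.\<close>

lemma dual_value_at_iterate:
  "dual_perturbed_objective f A b g (p (Suc k)) (y (Suc k))
    = ereal (\<phi> k - p (Suc k) \<bullet> x (Suc k) - u (Suc k) \<bullet> y (Suc k))"
proof (rule antisym)
  show "dual_perturbed_objective f A b g (p (Suc k)) (y (Suc k))
      \<le> ereal (\<phi> k - p (Suc k) \<bullet> x (Suc k) - u (Suc k) \<bullet> y (Suc k))"
    using dual_perturbed_objective_le[of f A b g "p (Suc k)" "y (Suc k)" "x (Suc k)" "u (Suc k)"]
    by (simp add: primal_value_at_iterate inner_commute)
  show "ereal (\<phi> k - p (Suc k) \<bullet> x (Suc k) - u (Suc k) \<bullet> y (Suc k))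
      \<le> dual_perturbed_objective f A b g (p (Suc k)) (y (Suc k))"
  proof (rule dual_perturbed_objective_ge[of f, OF f_not_minf y_nonneg])
    fix z
    show "ereal (\<phi> k - p (Suc k) \<bullet> x (Suc k) - u (Suc k) \<bullet> y (Suc k) + z \<bullet> p (Suc k))
        \<le> f z + ereal (constraint_pairing A b g z (y (Suc k)))"
      using lagrangian_subgradient[of k z] by (simp add: inner_diff_right inner_commute algebra_simps)
  qed
qed

lemma primal_objective_ge: "ereal v \<le> perturbed_objective f A b g z 0"
proof -
  have "ereal v \<le> f z + ereal (constraint_pairing A b g z ys)"
    using ys_certificate by (simp add: dual_certificate_def)
  also have "\<dots> \<le> perturbed_objective f A b g z 0 - ereal (0 \<bullet> ys)"
    using ys_certificate by (intro perturbed_objective_ge_pairing f_not_minf) (simp add: dual_certificate_def)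
  finally show ?thesis
    by (simp flip: zero_ereal_def)
qed

lemma primal_objective_solution: "perturbed_objective f A b g xs 0 = ereal v"
  by (simp add: perturbed_objective_def xs_value xs_eq xs_le)

lemma dual_objective_le: "dual_perturbed_objective f A b g 0 q \<le> ereal v"
  using dual_perturbed_objective_le[of f A b g 0 q xs 0]
  by (simp add: primal_objective_solution)

lemma dual_objective_certificate:
  assumes "dual_certificate f A b g v q"
  shows "dual_perturbed_objective f A b g 0 q = ereal v"
  using assms by (intro antisym dual_objective_le dual_perturbed_objective_ge f_not_minf)
    (auto simp: dual_certificate_def)

lemma is_arg_max_certificate:
  assumes "dual_certificate f A b g v q"
  shows "is_arg_max (dual_perturbed_objective f A b g 0) (\<lambda>_. True) q"
  using dual_objective_le by (simp add: is_arg_max_def dual_objective_certificate[OF assms] not_less)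

text \<open>Since u vanishes, continuity carries perturbed feasibility to feasibility of the limit.
  Lower semicontinuity bounds f there by v, and a feasible point cannot lie below v.\<close>

lemma primal_accumulation_point:
  assumes "accumulation_point x z"
  shows "f z = ereal v" "A *v z = b" "g z \<le> 0"
proof -
  obtain s where s: "strict_mono s" "(\<lambda>j. x (Suc (s j))) \<longlonglongrightarrow> z"
    using accumulation_point_SucE[OF assms] by blast
  have u: "(\<lambda>j. u (Suc (s j))) \<longlonglongrightarrow> 0"
    using LIMSEQ_subseq_LIMSEQ[OF u_tendsto_0 s(1)] by (simp add: o_def)
  have "(\<lambda>j. fst (u (Suc (s j)))) \<longlonglongrightarrow> 0"
    using tendsto_fst[OF u] by simp
  then have "(\<lambda>j. A *v x (Suc (s j)) - b + fst (u (Suc (s j)))) \<longlonglongrightarrow> A *v z - b + 0"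
    by (intro tendsto_add tendsto_diff tendsto_const s(2)
        bounded_linear.tendsto[OF matrix_vector_mul_bounded_linear])
  then show eq: "A *v z = b"
    by (simp add: u_feasible_eq LIMSEQ_const_iff)
  have "g z $ i \<le> 0" for i
  proof -
    have "isCont (\<lambda>z. g z $ i) z"
      using convex_on_continuous[OF open_UNIV g_convex[of i]] by (simp add: continuous_on_eq_continuous_at)
    from tendsto_add[OF isCont_tendsto_compose[OF this s(2)] tendsto_vec_nth[OF tendsto_snd[OF u], of i]]
    have "(\<lambda>j. g (x (Suc (s j))) $ i + snd (u (Suc (s j))) $ i) \<longlonglongrightarrow> g z $ i"
      by simp
    then show ?thesis
      by (rule LIMSEQ_le_const2) (use u_feasible_le in \<open>auto simp: less_eq_vec_def\<close>)
  qed
  then show le: "g z \<le> 0"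
    by (simp add: less_eq_vec_def)
  have "(\<lambda>j. f (x (Suc (s j)))) \<longlonglongrightarrow> ereal v"
    using LIMSEQ_subseq_LIMSEQ[OF \<phi>_tendsto s(1)] by (simp add: f_iterate o_def)
  then have "f z \<le> ereal v"
    by (rule lower_semicontinuous_le_limit[OF lsc s(2)])
  then show "f z = ereal v"
    using primal_objective_ge[of z] eq le by (simp add: perturbed_objective_def)
qed

text \<open>For fixed z, the subgradient inequality at the iterates passes to the limit: its left
  side tends to v and the pairing is continuous in y. Where f is infinite the bound is
  trivial.\<close>

lemma dual_accumulation_point:
  assumes "accumulation_point y q"
  shows "dual_certificate f A b g v q"
proof -
  obtain s where s: "strict_mono s" "(\<lambda>j. y (Suc (s j))) \<longlonglongrightarrow> q"
    using accumulation_point_SucE[OF assms] by blast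
  have nonneg: "0 \<le> snd q $ i" for i
  proof -
    have "(\<lambda>j. snd (y (Suc (s j))) $ i) \<longlonglongrightarrow> snd q $ i"
      by (intro tendsto_intros s(2))
    then show ?thesis
      by (rule LIMSEQ_le_const) (use y_nonneg in \<open>auto simp: less_eq_vec_def\<close>)
  qed
  have "ereal v \<le> f z + ereal (constraint_pairing A b g z q)" for z
  proof (cases "f z")
    case (real c)
    have "(\<lambda>k. \<phi> k - u (Suc k) \<bullet> y (Suc k) + p (Suc k) \<bullet> (z - x (Suc k))) \<longlonglongrightarrow> v - 0 + 0"
      by (intro tendsto_intros \<phi>_tendsto u_inner_y_tendsto_0 p_inner_diff_tendsto_0)
    from LIMSEQ_subseq_LIMSEQ[OF this s(1)]
    have "(\<lambda>j. \<phi> (s j) - u (Suc (s j)) \<bullet> y (Suc (s j)) + p (Suc (s j)) \<bullet> (z - x (Suc (s j)))) \<longlonglongrightarrow> v"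
      by (simp add: o_def)
    moreover have "(\<lambda>j. c + constraint_pairing A b g z (y (Suc (s j)))) \<longlonglongrightarrow> c + constraint_pairing A b g z q"
      unfolding constraint_pairing_def by (intro tendsto_intros s(2))
    ultimately have "v \<le> c + constraint_pairing A b g z q"
      by (rule LIMSEQ_le) (use lagrangian_subgradient[of _ z] in \<open>auto simp: real\<close>)
    then show ?thesis
      by (simp add: real)
  qed (use f_not_minf in auto)
  with nonneg show ?thesis
    by (simp add: dual_certificate_def less_eq_vec_def)
qed

text \<open>
  Opial's argument: the energies with respect to two cluster points of \<open>y\<close> share the terms in
  \<open>w\<close> and \<open>x\<close>, so the difference of squared distances to the two points converges.
\<close>

lemma dual_accumulation_point_unique:
  assumes "accumulation_point y q1" "accumulation_point y q2"
  shows "q1 = q2"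
proof -
  obtain s1 where s1: "strict_mono s1" "(y \<circ> s1) \<longlonglongrightarrow> q1"
    using assms(1) by (auto simp: accumulation_point_def)
  obtain s2 where s2: "strict_mono s2" "(y \<circ> s2) \<longlonglongrightarrow> q2"
    using assms(2) by (auto simp: accumulation_point_def)
  define D where "D k = (norm (y k - q1))\<^sup>2 - (norm (y k - q2))\<^sup>2" for k
  have "convergent (\<lambda>k. energy q1 k - energy q2 k)"
    by (intro convergent_diff energy_convergent dual_accumulation_point assms)
  then obtain d where d: "D \<longlonglongrightarrow> d"
    by (auto simp: energy_def D_def[abs_def] convergent_def)
  \<comment> \<open>The one limit d is minus the squared distance of the cluster points along one
    subsequence and plus it along the other, so the distance is 0.\<close>
  have "(D \<circ> s1) \<longlonglongrightarrow> (norm (q1 - q1))\<^sup>2 - (norm (q1 - q2))\<^sup>2"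
    using s1(2) unfolding D_def o_def by (intro tendsto_intros)
  then have "d = - (norm (q1 - q2))\<^sup>2"
    using LIMSEQ_unique[OF LIMSEQ_subseq_LIMSEQ[OF d s1(1)]] by simp
  moreover have "(D \<circ> s2) \<longlonglongrightarrow> (norm (q2 - q1))\<^sup>2 - (norm (q2 - q2))\<^sup>2"
    using s2(2) unfolding D_def o_def by (intro tendsto_intros)
  then have "d = (norm (q1 - q2))\<^sup>2"
    using LIMSEQ_unique[OF LIMSEQ_subseq_LIMSEQ[OF d s2(1)]] by (simp add: norm_minus_commute)
  ultimately show ?thesis
    by (smt (verit) power2_less_0 zero_le_power2 zero_eq_power2 norm_eq_zero eq_iff_diff_eq_0)
qed

lemma dual_converges:
  obtains q where "dual_certificate f A b g v q" "y \<longlonglongrightarrow> q"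
proof -
  obtain q where q: "accumulation_point y q"
    using bounded_accumulation_point[OF bounded_iterates(3)] by blast
  have "y \<longlonglongrightarrow> q"
    by (rule LIMSEQ_unique_accumulation_point[OF bounded_iterates(3)])
      (rule dual_accumulation_point_unique[OF _ q])
  with dual_accumulation_point[OF q] that show thesis
    by blast
qed

end

theorem theorem3p1:
  fixes f :: "real^'n \<Rightarrow> ereal"
    and A :: "real^'n^'m1" and b :: "real^'m1"
    and g :: "real^'n \<Rightarrow> real^'m2"
    and S :: "real^'n^'n"
    and \<rho> \<sigma>min \<tau>min :: real
    and \<sigma> \<tau> \<nu> :: "nat \<Rightarrow> real"
    and x \<Delta> w p :: "nat \<Rightarrow> real^'n"
    and l :: "nat \<Rightarrow> real^'m1" and \<mu> :: "nat \<Rightarrow> real^'m2"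
    and y u :: "nat \<Rightarrow> (real^'m1) \<times> (real^'m2)"
  assumes "proper_fun f" and "lower_semicontinuous f" and "convex_ereal_fun f"
    and "\<And>i. continuously_differentiable (\<lambda>z. g z $ i)"
    and "\<And>i. convex_on UNIV (\<lambda>z. g z $ i)"
    and "0 \<le> \<rho>" and "\<rho> < 1"
    and "sym_pos_def S"
    and "0 < \<sigma>min" and "\<And>k. \<sigma>min \<le> \<sigma> k"
    and "0 < \<tau>min" and "\<And>k. \<tau>min \<le> \<tau> k"
    and "\<And>k. \<tau> (Suc k) \<le> (1 + \<nu> k) * \<tau> k"
    and "\<And>k. 0 \<le> \<nu> k" and "summable \<nu>"
    and "rip2ALM f A b g \<rho> \<sigma> \<tau> S x \<Delta> w l \<mu>"
    and "\<And>k. y k = (l k, \<mu> k)"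
    and "\<And>k. p (Suc k) = \<Delta> (Suc k) - (\<tau> k / \<sigma> k) *\<^sub>R (S *v (x (Suc k) - x k))"
    and "\<And>k. u (Suc k) = (1 / \<sigma> k) *\<^sub>R (y k - y (Suc k))"
    and "lagrangian_subdifferential_inv f A b g 0 0 \<noteq> {}"
  shows "(bounded (range x) \<and> bounded (range w) \<and> bounded (range y))
    \<and> ((\<lambda>k. \<Delta> (Suc k)) \<longlonglongrightarrow> 0 \<and> (\<lambda>k. p (Suc k)) \<longlonglongrightarrow> 0 \<and> (\<lambda>k. u (Suc k)) \<longlonglongrightarrow> 0)
    \<and> (\<exists>v::real.
         (INF z. perturbed_objective f A b g z 0) = ereal v
       \<and> (SUP q. dual_perturbed_objective f A b g 0 q) = ereal v
       \<and> (\<lambda>k. perturbed_objective f A b g (x (Suc k)) (u (Suc k))) \<longlonglongrightarrow> ereal v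
       \<and> (\<lambda>k. dual_perturbed_objective f A b g (p (Suc k)) (y (Suc k))) \<longlonglongrightarrow> ereal v)
    \<and> (\<forall>z. accumulation_point x z \<longrightarrow>
         is_arg_min (\<lambda>z'. perturbed_objective f A b g z' 0) (\<lambda>_. True) z
       \<and> is_arg_min f (\<lambda>z'. A *v z' = b \<and> g z' \<le> 0) z)
    \<and> (\<forall>q. accumulation_point y q \<longrightarrow>
         is_arg_max (dual_perturbed_objective f A b g 0) (\<lambda>_. True) q)
    \<and> (\<exists>q. is_arg_max (dual_perturbed_objective f A b g 0) (\<lambda>_. True) q \<and> y \<longlonglongrightarrow> q)"
proof -
  obtain xs ys where saddle: "(xs, ys) \<in> lagrangian_subdifferential_inv f A b g 0 0"
    using assms(20) by (auto simp del: split_paired_Ex)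
  obtain v where v: "f xs = ereal v" "A *v xs = b" "g xs \<le> 0" "dual_certificate f A b g v ys"
    using saddle_pointE[OF saddle assms(1)] by blast
  interpret rip2ALM_run f A b g S \<rho> \<sigma>min \<tau>min \<sigma> \<tau> \<nu> x \<Delta> w p l \<mu> y u xs v ys
    by (unfold_locales; fact assms v)
  have primal: "(INF z. perturbed_objective f A b g z 0) = ereal v"
    by (rule antisym[OF INF_lower2[of xs] INF_greatest])
      (simp_all add: primal_objective_solution primal_objective_ge)
  have dual: "(SUP q. dual_perturbed_objective f A b g 0 q) = ereal v"
    by (rule antisym[OF SUP_least SUP_upper2[of ys]])
      (simp_all add: dual_objective_le dual_objective_certificate[OF v(4)])
  have primal_limit: "(\<lambda>k. perturbed_objective f A b g (x (Suc k)) (u (Suc k))) \<longlonglongrightarrow> ereal v"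
    unfolding primal_value_at_iterate by (intro tendsto_ereal \<phi>_tendsto)
  \<comment> \<open>Both inner products pair a null sequence with a bounded one, so G inherits the
    limit of \<phi>.\<close>
  have "(\<lambda>k. \<phi> k - p (Suc k) \<bullet> x (Suc k) - u (Suc k) \<bullet> y (Suc k)) \<longlonglongrightarrow> v - 0 - 0"
    by (intro tendsto_diff \<phi>_tendsto p_inner_x_tendsto_0 u_inner_y_tendsto_0)
  then have dual_limit: "(\<lambda>k. dual_perturbed_objective f A b g (p (Suc k)) (y (Suc k))) \<longlonglongrightarrow> ereal v"
    unfolding dual_value_at_iterate by (intro tendsto_ereal) simp
  have primal_opt: "is_arg_min (\<lambda>z'. perturbed_objective f A b g z' 0) (\<lambda>_. True) z
      \<and> is_arg_min f (\<lambda>z'. A *v z' = b \<and> g z' \<le> 0) z"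
    if "accumulation_point x z" for z
  proof -
    note z = primal_accumulation_point[OF that]
    have "ereal v \<le> f z'" if "A *v z' = b" "g z' \<le> 0" for z'
      using primal_objective_ge[of z'] that by (simp add: perturbed_objective_def)
    moreover have "perturbed_objective f A b g z 0 = ereal v"
      by (simp add: perturbed_objective_def z)
    ultimately show ?thesis
      using primal_objective_ge by (auto simp: is_arg_min_def z not_less)
  qed
  have dual_opt: "is_arg_max (dual_perturbed_objective f A b g 0) (\<lambda>_. True) q"
    if "accumulation_point y q" for q
    using that by (intro is_arg_max_certificate dual_accumulation_point)
  have "\<exists>q. is_arg_max (dual_perturbed_objective f A b g 0) (\<lambda>_. True) q \<and> y \<longlonglongrightarrow> q"
    using dual_converges is_arg_max_certificate by blast
  then show ?thesis
    using bounded_iterates \<Delta>_tendsto_0 p_tendsto_0 u_tendsto_0 primal dual primal_limit dual_limit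
      primal_opt dual_opt by blast
qed

end
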